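(* The cut locus from the identity for the $\mathbf{k}\oplus\mathbf{p}$ sub-Riemannian problem on $SU(2)$ is $$K_{\mathrm{Id}}=e^{\mathbf{k}}\setminus\{\mathrm{Id}\}=\{e^{ck}\mid c\in(0,4\pi)\}.$$
   Context: In $su(2)$ let $p_1=\frac12\begin{pmatrix}0&1\\-1&0\end{pmatrix}$, $p_2=\frac12\begin{pmatrix}0&i\\i&0\end{pmatrix}$, $k=\frac12\begin{pmatrix}i&0\\0&-i\end{pmatrix}$, $\mathbf{k}=\mathrm{span}\{k\}$, $\mathbf{p}=\mathrm{span}\{p_1,p_2\}$; $e^{\mathbf{k}}$ is the image of $\mathbf{k}$ under the matrix exponential. The $\mathbf{k}\oplus\mathbf{p}$ sub-Riemannian structure on $SU(2)$ is the left-invariant one with distribution $\Delta(g)=g\mathbf{p}$ and metric $\mathbf{g}_g(v_1,v_2)=\langle g^{-1}v_1,g^{-1}v_2\rangle$, where $\langle\cdot,\cdot\rangle$ is the inner product on $\mathbf{p}$ with $\{p_1,p_2\}$ orthonormal. A Lipschitz curve $\gamma:[0,T]\to SU(2)$ is horizontal if $\dot\gamma(t)\in\Delta(\gamma(t))$ for a.e. $t$; its length is $\int_0^T\sqrt{\mathbf{g}_\gamma(\dot\gamma,\dot\gamma)}\,dt$; $d(q_0,q_1)$ is the infimum of lengths of horizontal curves joining $q_0$ and $q_1$. The geodesics starting from the identity and parametrized by arclength are the curves $t\mapsto\mathrm{Exp}(\theta,c,t)=e^{(\cos\theta\,p_1+\sin\theta\,p_2+ck)t}e^{-ckt}$, $\theta\in\mathbb{R}/2\pi$,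 $c\in\mathbb{R}$. Such a geodesic is optimal on $[0,t]$ if $d(\mathrm{Id},\mathrm{Exp}(\theta,c,t))=t$. The cut locus $K_{\mathrm{Id}}$ is the set of points $q$ for which there exist $(\theta_1,c_1)\neq(\theta_2,c_2)$ and $t>0$ with $q=\mathrm{Exp}(\theta_1,c_1,t)=\mathrm{Exp}(\theta_2,c_2,t)$ and both $\mathrm{Exp}(\theta_i,c_i,\cdot)$ optimal on $[0,t]$. *)

theory Defs
  imports "HOL-Analysis.Analysis" "HOL-Library.Real_Mod"
begin

type_synonym cmat2 = "complex^2^2"

primrec matrix_power :: "('a::semiring_1)^'n^'n \<Rightarrow> nat \<Rightarrow> 'a^'n^'n" where
  "matrix_power A 0 = mat 1"
| "matrix_power A (Suc n) = A ** matrix_power A n"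

text \<open>The multiplication \<open>*\<close> on \<^typ>\<open>complex^2^2\<close> is componentwise and the type is not a
  normed algebra, so the library's \<open>exp\<close> is not available for matrices.\<close>

definition matrix_exp :: "cmat2 \<Rightarrow> cmat2" where
  "matrix_exp A = (\<Sum>n. matrix_power A n /\<^sub>R fact n)"

definition conj_transpose :: "cmat2 \<Rightarrow> cmat2" where
  "conj_transpose A = (\<chi> i j. cnj (A $ j $ i))"

definition SU2 :: "cmat2 set" where
  "SU2 = {g. conj_transpose g ** g = mat 1 \<and> det g = 1}"

definition p1 :: cmat2 where
  "p1 = (1/2) *\<^sub>R vector [vector [0, 1], vector [-1, 0]]"

definition p2 :: cmat2 where
  "p2 = (1/2) *\<^sub>R vector [vector [0, \<i>], vector [\<i>, 0]]"

definition k0 :: cmat2 where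
  "k0 = (1/2) *\<^sub>R vector [vector [\<i>, 0], vector [0, -\<i>]]"

text \<open>Here \<^const>\<open>span\<close> is the real linear span.\<close>

definition k_part :: "cmat2 set" where
  "k_part = span {k0}"

definition p_part :: "cmat2 set" where
  "p_part = span {p1, p2}"

text \<open>The inner product on \<open>p_part\<close> for which \<open>p1\<close>, \<open>p2\<close> is orthonormal;
  \<open>representation B X b\<close> is the coordinate of \<open>X\<close> along the basis vector \<open>b\<close> of \<open>B\<close>.
  The values outside \<open>p_part\<close> are irrelevant.\<close>

definition p_inner :: "cmat2 \<Rightarrow> cmat2 \<Rightarrow> real" where
  "p_inner X Y =
     (\<Sum>b\<in>{p1, p2}. representation {p1, p2} X b * representation {p1, p2} Y b)"

definition distribution :: "cmat2 \<Rightarrow> cmat2 set" where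
  "distribution g = (\<lambda>X. g ** X) ` p_part"

definition sr_metric :: "cmat2 \<Rightarrow> cmat2 \<Rightarrow> cmat2 \<Rightarrow> real" where
  "sr_metric g v w = p_inner (matrix_inv g ** v) (matrix_inv g ** w)"

text \<open>Lipschitz continuity is taken with respect to the Euclidean norm on matrices. As \<open>SU2\<close> is a
  compact submanifold, any Riemannian distance on it gives the same class of curves.\<close>

definition horizontal :: "real \<Rightarrow> (real \<Rightarrow> cmat2) \<Rightarrow> bool" where
  "horizontal T \<gamma> \<longleftrightarrow>
     (\<exists>L. L-lipschitz_on {0..T} \<gamma>) \<and> \<gamma> ` {0..T} \<subseteq> SU2 \<and>
     (AE t in lebesgue_on {0..T}.
        \<exists>v\<in>distribution (\<gamma> t). (\<gamma> has_vector_derivative v) (at t within {0..T}))"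

definition sr_length :: "real \<Rightarrow> (real \<Rightarrow> cmat2) \<Rightarrow> real" where
  "sr_length T \<gamma> =
     (LINT t|lebesgue_on {0..T}.
        (let v = vector_derivative \<gamma> (at t within {0..T}) in sqrt (sr_metric (\<gamma> t) v v)))"

definition sr_dist :: "cmat2 \<Rightarrow> cmat2 \<Rightarrow> real" where
  "sr_dist q0 q1 =
     Inf {sr_length T \<gamma> | T \<gamma>. 0 < T \<and> horizontal T \<gamma> \<and> \<gamma> 0 = q0 \<and> \<gamma> T = q1}"

definition Exp :: "real \<Rightarrow> real \<Rightarrow> real \<Rightarrow> cmat2" where
  "Exp \<theta> c t =
     matrix_exp (t *\<^sub>R (cos \<theta> *\<^sub>R p1 + sin \<theta> *\<^sub>R p2 + c *\<^sub>R k0)) ** matrix_exp (- (c * t) *\<^sub>R k0)"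

definition optimal :: "real \<Rightarrow> real \<Rightarrow> real \<Rightarrow> bool" where
  "optimal \<theta> c t \<longleftrightarrow> sr_dist (mat 1) (Exp \<theta> c t) = t"

text \<open>The angle is a point of the circle, so two pairs of parameters are distinct only if
  the second components differ or the angles differ modulo \<open>2 * pi\<close>.\<close>

definition cut_locus :: "cmat2 set" where
  "cut_locus = {q. \<exists>\<theta>\<^sub>1 c\<^sub>1 \<theta>\<^sub>2 c\<^sub>2 t.
     \<not> ([\<theta>\<^sub>1 = \<theta>\<^sub>2] (rmod (2 * pi)) \<and> c\<^sub>1 = c\<^sub>2) \<and> 0 < t \<and>
     q = Exp \<theta>\<^sub>1 c\<^sub>1 t \<and> q = Exp \<theta>\<^sub>2 c\<^sub>2 t \<and> optimal \<theta>\<^sub>1 c\<^sub>1 t \<and> optimal \<theta>\<^sub>2 c\<^sub>2 t}"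

end

(*
  A matrix of SU(2) is given by its first row (a, b). Along a horizontal curve of speed W one has
  |a'| = W/2 sqrt(1 - |a|^2). Optimality of the geodesics ending on exp(k): let a run from 1 to
  exp(i (pi - m)) with |m| < pi. Multiply a by exp(i mu), where mu grows from 0 to m in proportion to
  the length travelled; the real part r of the product runs from 1 to -1, and the Cauchy-Schwarz
  inequality gives |r'| <= sqrt(1 - r^2) sqrt(W^2/4 + mu'^2). Integrating the derivative of arcsin r
  yields pi^2 <= L^2/4 + m^2 for the length L, with equality for a geodesic that returns to exp(k)
  at the time 2 pi / sqrt(1 + c^2).

  Conversely no geodesic is optimal beyond that time, because it can then be replaced by one with a
  cusp on exp(k), and the cusp can be cut off. Up to that time |b| determines c up to sign, a
  determines the sign, and b determines the angle unless b = 0, that is, unless the end point is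
  on exp(k).
*)
theory Submission
  imports Defs
begin

section \<open>Matrices in SU(2) and the geodesics\<close>

text \<open>The factor exp(i mu) undoes the factor exp(-c t k) in the formula for the geodesics. In
  the frame that turns at the rate c/2 a geodesic is a one-parameter subgroup, hence a great circle
  of the unit quaternions, and at the time 2 pi / sqrt(1 + c^2) it has gone half way round, from 1
  to -1; m is the value of c t / 2 at that time. With q the imaginary part of the product, 1 - r^2 =
  |b|^2 + q^2, so the estimate for r' is the one for the spherical distance from 1, which is sharp
  on great circles.

  Two obstacles shape the lower bound. The speed of a Lipschitz curve is merely measurable and may
  vanish, so an angle proportional to the length need not be C^1. It is replaced by the normalised
  integral of a positive continuous function close to the speed in L^1, and the limit is taken only
  in the final inequality. Moreover arcsin has infinite slope at 1 and -1, exactly where the path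
  begins and ends; therefore r is first scaled by a factor below 1.\<close>

definition su :: "complex \<Rightarrow> complex \<Rightarrow> cmat2" where
  "su a b = vector [vector [a, b], vector [- cnj b, cnj a]]"

lemma su_nth [simp]:
  "su a b $ 1 $ 1 = a" "su a b $ 1 $ 2 = b" "su a b $ 2 $ 1 = - cnj b" "su a b $ 2 $ 2 = cnj a"
  by (simp_all add: su_def)

lemma su_eq_iff: "su a b = su c d \<longleftrightarrow> a = c \<and> b = d"
  by (metis su_nth(1,2))

lemma su_add: "su a b + su c d = su (a + c) (b + d)"
  by (simp add: vec_eq_iff forall_2)

lemma su_scaleR: "r *\<^sub>R su a b = su (r *\<^sub>R a) (r *\<^sub>R b)"
  by (simp add: vec_eq_iff forall_2)

text \<open>Quaternion multiplication: \<open>su a b\<close> stands for a + b j with j z = cnj z j.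
  The matrices \<open>su a b\<close> form a real algebra that contains the generators, and SU(2) is
  its unit sphere.\<close>

lemma su_mult: "su a b ** su c d = su (a * c - b * cnj d) (a * d + b * cnj c)"
  by (simp add: vec_eq_iff forall_2 matrix_matrix_mult_def sum_2 algebra_simps)

lemma su_one: "su 1 0 = mat 1"
  by (simp add: vec_eq_iff forall_2 mat_def)

lemma su_zero: "su 0 0 = 0"
  by (simp add: vec_eq_iff forall_2)

lemma p1_eq_su: "p1 = su 0 (1/2)"
  by (simp add: p1_def vec_eq_iff forall_2 complex_eq_iff)

lemma p2_eq_su: "p2 = su 0 (\<i>/2)"
  by (simp add: p2_def vec_eq_iff forall_2 complex_eq_iff)

lemma k0_eq_su: "k0 = su (\<i>/2) 0"
  by (simp add: k0_def vec_eq_iff forall_2 complex_eq_iff)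

lemma su_in_SU2_iff: "su a b \<in> SU2 \<longleftrightarrow> (cmod a)\<^sup>2 + (cmod b)\<^sup>2 = 1"
proof -
  have "(conj_transpose (su a b) ** su a b = mat 1 \<and> det (su a b) = 1)
      \<longleftrightarrow> a * cnj a + b * cnj b = 1"
    by (auto simp: vec_eq_iff forall_2 matrix_matrix_mult_def sum_2 conj_transpose_def det_2
        mat_def algebra_simps)
  also have "a * cnj a + b * cnj b = of_real ((cmod a)\<^sup>2 + (cmod b)\<^sup>2)"
    by (simp only: of_real_add complex_norm_square)
  also have "\<dots> = 1 \<longleftrightarrow> (cmod a)\<^sup>2 + (cmod b)\<^sup>2 = 1"
    by (metis of_real_1 of_real_eq_iff)
  finally show ?thesis by (simp add: SU2_def)
qed

text \<open>The inverse of g is its conjugate transpose and, as the determinant is 1, also its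
  adjugate; comparing the two gives the second row.\<close>

lemma SU2_eq_su:
  assumes "g \<in> SU2"
  shows "g = su (g $ 1 $ 1) (g $ 1 $ 2)"
proof -
  define a b c d where abcd: "a = g $ 1 $ 1" "b = g $ 1 $ 2" "c = g $ 2 $ 1" "d = g $ 2 $ 2"
  have e: "cnj a * a + cnj c * c = 1" "cnj a * b + cnj c * d = 0" "a * d - b * c = 1"
    using assms unfolding SU2_def abcd
    by (auto simp: vec_eq_iff forall_2 matrix_matrix_mult_def sum_2 conj_transpose_def det_2 mat_def)
  have d: "d = cnj a"
    using e by algebra
  have "b = - cnj c"
    using e by algebra
  then have c: "c = - cnj b" by simp
  show ?thesis
    using c d unfolding abcd by (simp add: vec_eq_iff forall_2)
qed

lemma bounded_linear_su: "bounded_linear (\<lambda>p. su (fst p) (snd p))"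
  by (intro linear_conv_bounded_linear[THEN iffD1] linearI) (simp_all add: su_add su_scaleR)

lemma has_vector_derivative_su:
  assumes "(a has_vector_derivative a') (at x within S)" "(b has_vector_derivative b') (at x within S)"
  shows "((\<lambda>t. su (a t) (b t)) has_vector_derivative su a' b') (at x within S)"
  using bounded_linear.has_vector_derivative[OF bounded_linear_su has_vector_derivative_Pair[OF assms]]
  by simp

text \<open>Each entry occurs twice up to conjugation and sign; this 2 is the source of the factors
  \<open>sqrt 2\<close> between Euclidean and sub-Riemannian speed.\<close>

lemma norm_su: "(norm (su a b))\<^sup>2 = 2 * ((cmod a)\<^sup>2 + (cmod b)\<^sup>2)"
  by (simp add: norm_vec_def L2_set_def sum_2 real_sqrt_pow2)

section \<open>Distribution and metric in complex coordinates\<close>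

lemma p_combination: "x *\<^sub>R p1 + y *\<^sub>R p2 = su 0 (Complex x y / 2)"
  by (simp add: p1_eq_su p2_eq_su su_scaleR su_add su_eq_iff complex_eq_iff)

text \<open>A horizontal direction is encoded by one complex control w, whose real and imaginary
  parts are the coordinates along \<open>p1\<close> and \<open>p2\<close>.\<close>

lemma p_part_eq: "p_part = range (\<lambda>w. su 0 (w / 2))"
proof -
  have "p_part = {x *\<^sub>R p1 + y *\<^sub>R p2 |x y. True}"
    unfolding p_part_def span_insert
    by (auto simp: span_singleton algebra_simps)
  also have "\<dots> = range (\<lambda>w. su 0 (w / 2))"
    unfolding p_combination by (auto simp: image_iff intro: complex.exhaust) (metis complex.collapse)
  finally show ?thesis .
qed

lemma independent_p1_p2: "p1 \<noteq> p2" "independent {p1, p2}"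
proof -
  show ne: "p1 \<noteq> p2"
    by (simp add: p1_eq_su p2_eq_su su_eq_iff complex_eq_iff)
  have "p1 \<noteq> r *\<^sub>R p2" for r
    by (simp add: p1_eq_su p2_eq_su su_scaleR su_eq_iff complex_eq_iff)
  moreover have "p2 \<noteq> 0"
    by (simp add: p2_eq_su su_eq_iff complex_eq_iff flip: su_zero)
  ultimately show "independent {p1, p2}"
    using ne by (auto simp: independent_insert span_singleton)
qed

lemma p_inner_self: "p_inner (su 0 (w / 2)) (su 0 (w / 2)) = (cmod w)\<^sup>2"
proof -
  have p: "p1 \<in> span {p1, p2}" "p2 \<in> span {p1, p2}"
    by (auto intro: span_base)
  have eq: "su 0 (w / 2) = Re w *\<^sub>R p1 + Im w *\<^sub>R p2"
    by (simp add: p_combination)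
  have "representation {p1, p2} (su 0 (w / 2)) =
      (\<lambda>b. Re w * (if b = p1 then 1 else 0) + Im w * (if b = p2 then 1 else 0))"
    unfolding eq using p independent_p1_p2(2)
    by (simp add: representation_add representation_scale representation_basis span_scale)

  then show ?thesis
    using independent_p1_p2(1) by (simp add: p_inner_def cmod_power2) (simp add: power2_eq_square)
qed

lemma distribution_su: "distribution (su a b) = range (\<lambda>w. su (- (b * cnj w) / 2) (a * w / 2))"
  by (simp add: distribution_def p_part_eq image_image su_mult)

lemma sr_metric_su:
  assumes "su a b \<in> SU2"
  shows "sr_metric (su a b) (su (- (b * cnj w) / 2) (a * w / 2)) (su (- (b * cnj w) / 2) (a * w / 2))
    = (cmod w)\<^sup>2"
proof -
  have det: "a * cnj a + b * cnj b = 1"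
    using assms unfolding su_in_SU2_iff by (metis complex_norm_square of_real_1 of_real_add)
  then have "su a b ** su (cnj a) (- b) = mat 1"
    by (simp add: su_mult algebra_simps flip: su_one)
  \<comment> \<open>\<open>matrix_inv\<close> is a choice among two-sided inverses; the explicit
    right inverse shows that there is one to choose.\<close>
  then have inv: "matrix_inv (su a b) ** su a b = mat 1"
    unfolding matrix_inv_def by (metis (mono_tags, lifting) matrix_left_right_inverse someI_ex)
  have "matrix_inv (su a b) ** su (- (b * cnj w) / 2) (a * w / 2)
      = matrix_inv (su a b) ** (su a b ** su 0 (w / 2))"
    by (simp add: su_mult)
  also have "\<dots> = su 0 (w / 2)"
    by (simp add: matrix_mul_assoc inv)
  finally show ?thesis
    by (simp add: sr_metric_def p_inner_self)
qed

section \<open>Closed forms for the exponential and the geodesics\<close>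

lemma matrix_exp_square_scalar:
  fixes M :: cmat2
  assumes "M ** M = (- (\<kappa>\<^sup>2)) *\<^sub>R mat 1" "\<kappa> \<noteq> 0"
  shows "matrix_exp M = cos \<kappa> *\<^sub>R mat 1 + (sin \<kappa> / \<kappa>) *\<^sub>R M"
proof -
  let ?z = "\<i> * of_real \<kappa> :: complex"
  \<comment> \<open>\<open>F\<close> embeds the complex numbers as the algebra generated by M, with
    \<i>\<kappa> going to M. Being linear and bounded, it carries the series of exp(\<i>\<kappa>) to
    that of M.\<close>
  define F where "F z = Re z *\<^sub>R mat 1 + (Im z / \<kappa>) *\<^sub>R M" for z
  have bl: "bounded_linear F"
    unfolding F_def
    by (intro linear_conv_bounded_linear[THEN iffD1] linearI)
      (simp_all add: algebra_simps add_divide_distrib)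
  have pow: "matrix_power M n = F (?z ^ n)" for n
  proof (induction n)
    case 0
    then show ?case by (simp add: F_def)
  next
    case (Suc n)
    have MF: "M ** F z = Re z *\<^sub>R M + (Im z / \<kappa>) *\<^sub>R (M ** M)" for z
      by (simp add: F_def vec_eq_iff forall_2 matrix_matrix_mult_def sum_2 mat_def algebra_simps)
    show ?case
      using assms(2) by (simp add: Suc MF assms(1)) (simp add: F_def power2_eq_square)
  qed
  have "(\<lambda>n. ?z ^ n /\<^sub>R fact n) sums exp ?z"
    by (rule exp_converges)
  then have "(\<lambda>n. F (?z ^ n /\<^sub>R fact n)) sums F (exp ?z)"
    by (rule bounded_linear.sums[OF bl])
  then have "(\<lambda>n. matrix_power M n /\<^sub>R fact n) sums F (exp ?z)"
    by (simp add: pow linear_cmul[OF bounded_linear.linear[OF bl]])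
  moreover have "exp ?z = cis \<kappa>"
    by (simp add: cis_conv_exp)
  ultimately show ?thesis
    by (simp add: matrix_exp_def sums_iff F_def)
qed

lemma matrix_exp_zero: "matrix_exp 0 = mat 1"
proof -
  have "matrix_power (0::cmat2) n /\<^sub>R fact n = (if n = 0 then mat 1 else 0)" for n
    by (cases n) (auto simp: vec_eq_iff matrix_matrix_mult_def)
  then show ?thesis
    unfolding matrix_exp_def by (simp add: sums_iff[THEN iffD1, OF sums_single[of 0 "\<lambda>_. mat 1"]])
qed

lemma matrix_exp_k: "matrix_exp (c *\<^sub>R k0) = su (cis (c / 2)) 0"
proof (cases "c = 0")
  case True
  then show ?thesis by (simp add: matrix_exp_zero su_one)
next
  case False
  have "(c *\<^sub>R k0) ** (c *\<^sub>R k0) = (- ((c/2)\<^sup>2)) *\<^sub>R mat 1"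
    by (simp add: k0_eq_su su_scaleR su_mult su_eq_iff complex_eq_iff power2_eq_square flip: su_one)
  from matrix_exp_square_scalar[OF this] False show ?thesis
    by (simp add: k0_eq_su su_scaleR su_add su_eq_iff complex_eq_iff flip: su_one)
qed

lemma Exp_eq_su:
  fixes c :: real
  defines "\<omega> \<equiv> sqrt (1 + c\<^sup>2)"
  shows "Exp \<theta> c t = su (Complex (cos (\<omega> * t / 2)) (c / \<omega> * sin (\<omega> * t / 2)) * cis (- (c * t / 2)))
    (cis \<theta> * of_real (sin (\<omega> * t / 2) / \<omega>) * cis (c * t / 2))"
proof -
  let ?M = "t *\<^sub>R (cos \<theta> *\<^sub>R p1 + sin \<theta> *\<^sub>R p2 + c *\<^sub>R k0)"
  have om: "\<omega> > 0" "\<omega>\<^sup>2 = 1 + c\<^sup>2"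
    by (simp_all add: \<omega>_def add_pos_nonneg)
  have M: "?M = su (\<i> * of_real (c * t / 2)) (of_real (t/2) * cis \<theta>)"
    by (simp add: p_combination k0_eq_su su_add su_scaleR su_eq_iff complex_eq_iff)
  have "matrix_exp ?M = su (Complex (cos (\<omega> * t / 2)) (c / \<omega> * sin (\<omega> * t / 2)))
      (cis \<theta> * of_real (sin (\<omega> * t / 2) / \<omega>))"
  proof (cases "t = 0")
    case True
    then show ?thesis by (simp add: matrix_exp_zero su_one complex_eq_iff su_eq_iff flip: su_one)
  next
    case False
    have cs: "cos \<theta> * cos \<theta> + sin \<theta> * sin \<theta> = 1"
      using sin_cos_squared_add3 by auto
    have "?M ** ?M = (- ((\<omega> * t / 2)\<^sup>2)) *\<^sub>R mat 1"
      unfolding M power_mult_distrib power_divide om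
      using cs by (simp add: su_scaleR su_mult su_eq_iff complex_eq_iff power2_eq_square field_simps
          flip: su_one distrib_left)
    from matrix_exp_square_scalar[OF this] False om(1) show ?thesis
      unfolding M by (simp add: su_scaleR su_add su_eq_iff complex_eq_iff flip: su_one)
  qed
  moreover have "matrix_exp (- (c * t) *\<^sub>R k0) = su (cis (- (c * t / 2))) 0"
    using matrix_exp_k[of "- (c * t)"] by simp
  ultimately show ?thesis
    unfolding Exp_def by (simp add: su_mult cis_cnj)
qed

section \<open>Lipschitz curves\<close>

lemma has_vector_derivative_imp_quotient_tendsto:
  fixes f :: "real \<Rightarrow> 'a::real_normed_vector"
  assumes "(f has_vector_derivative D) (at x)" "h \<longlonglongrightarrow> 0" "\<And>n. h n \<noteq> 0"
  shows "(\<lambda>n. (f (x + h n) - f x) /\<^sub>R h n) \<longlonglongrightarrow> D"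
proof -
  have "(\<lambda>h. norm (f (x + h) - f x - h *\<^sub>R D) / norm h) \<midarrow>0\<rightarrow> 0"
    using assms(1) by (simp add: has_vector_derivative_def has_derivative_at)
  moreover have "filterlim h (at 0) sequentially"
    using assms(2,3) by (simp add: filterlim_at)
  ultimately have "(\<lambda>n. norm (f (x + h n) - f x - h n *\<^sub>R D) / norm (h n)) \<longlonglongrightarrow> 0"
    by (rule filterlim_compose)
  moreover have "norm (f (x + h n) - f x - h n *\<^sub>R D) / norm (h n)
      = norm ((f (x + h n) - f x) /\<^sub>R h n - D)" for n
  proof -
    have "(f (x + h n) - f x) /\<^sub>R h n - D = (f (x + h n) - f x - h n *\<^sub>R D) /\<^sub>R h n"
      using assms(3)[of n] by (simp add: algebra_simps)
    then show ?thesis by (simp add: divide_inverse_commute)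
  qed
  ultimately show ?thesis
    by (simp add: LIM_zero_iff tendsto_norm_zero_iff)
qed

lemma AE_lebesgue_on_Icc_minus_finite:
  fixes a b :: real
  assumes "finite N"
  shows "AE t in lebesgue_on {a..b}. t \<in> {a..b} - N"
proof -
  have "N \<inter> {a..b} \<in> null_sets (lebesgue_on {a..b})"
    by (intro null_sets_restrict_space[THEN iffD2])
      (auto simp: null_sets_completionI finite_imp_null_set_lborel assms)
  then have "AE t in lebesgue_on {a..b}. t \<notin> N \<inter> {a..b}"
    by (rule AE_not_in)
  moreover have "AE t in lebesgue_on {a..b}. t \<in> {a..b}"
    by (rule AE_I2) simp
  ultimately show ?thesis
    by eventually_elim auto
qed

text \<open>Extending f by constants beyond the ends makes the difference quotients defined and
  bounded by L on the whole line. Their integrals are computed with an antiderivative G of the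
  extension: the integral of a quotient is the difference of two quotients of G, taken at b and at
  a. Dominated convergence along these quotients gives both the fundamental theorem and the
  approximation of the speed.\<close>

lemma lipschitz_difference_quotients:
  fixes f :: "real \<Rightarrow> 'a::euclidean_space"
  assumes ab: "a \<le> b" and lip: "L-lipschitz_on {a..b} f"
    and deriv: "AE t in lebesgue_on {a..b}. (f has_vector_derivative f' t) (at t within {a..b})"
  obtains q :: "nat \<Rightarrow> real \<Rightarrow> 'a" where
    "\<And>n. continuous_on UNIV (q n)" "\<And>n t. norm (q n t) \<le> L"
    "AE t in lebesgue_on {a..b}. (\<lambda>n. q n t) \<longlonglongrightarrow> f' t"
    "(\<lambda>n. integral {a..b} (q n)) \<longlonglongrightarrow> f b - f a"
proof -
  define F where "F x = f (max a (min b x))" for x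
  define h where "h n = 1 / real (Suc n)" for n
  define q where "q n t = (F (t + h n) - F t) /\<^sub>R h n" for n t
  have h: "h n > 0" "h n \<le> 1" for n
    by (auto simp: h_def)
  have h0: "h \<longlonglongrightarrow> 0"
    unfolding h_def using LIMSEQ_inverse_real_of_nat by (simp add: inverse_eq_divide)
  have F_lip: "norm (F x - F y) \<le> L * \<bar>x - y\<bar>" for x y
  proof -
    have "dist (F x) (F y) \<le> L * dist (max a (min b x)) (max a (min b y))"
      unfolding F_def using ab by (intro lipschitz_onD[OF lip]) auto
    also have "\<dots> \<le> L * \<bar>x - y\<bar>"
      using ab by (intro mult_left_mono lipschitz_on_nonneg[OF lip]) (auto simp: dist_real_def)
    finally show ?thesis by (simp add: dist_norm)
  qed
  have F_cont: "continuous_on S F" for S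
    by (rule lipschitz_on_continuous_on[of L], rule lipschitz_onI)
      (use F_lip lipschitz_on_nonneg[OF lip] in \<open>auto simp: dist_norm\<close>)
  have q_cont: "continuous_on UNIV (q n)" for n
    unfolding q_def by (intro continuous_intros continuous_on_compose2[OF F_cont[of UNIV]]) auto
  moreover have "norm (q n t) \<le> L" for n t
    using F_lip[of "t + h n" t] h(1)[of n] by (simp add: q_def divide_simps)
  moreover have "AE t in lebesgue_on {a..b}. (\<lambda>n. q n t) \<longlonglongrightarrow> f' t"
  proof -
    \<comment> \<open>At the ends only a one-sided derivative is given, and F is constant on the
      other side.\<close>
    have "AE t in lebesgue_on {a..b}. t \<in> {a..b} - {a, b}"
      by (rule AE_lebesgue_on_Icc_minus_finite) simp
    with deriv show ?thesis
    proof eventually_elim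
      case (elim t)
      then have t: "a < t" "t < b" by auto
      then have "(f has_vector_derivative f' t) (at t)"
        using elim by (simp add: at_within_Icc_at)
      then have "(F has_vector_derivative f' t) (at t)"
        by (rule has_vector_derivative_transform_within_open[of _ _ _ "{a<..<b}"])
          (use t in \<open>auto simp: F_def max_def min_def\<close>)
      then show ?case
        unfolding q_def using h0 h by (intro has_vector_derivative_imp_quotient_tendsto) (auto simp: less_imp_neq[THEN not_sym])
    qed
  qed
  moreover have "(\<lambda>n. integral {a..b} (q n)) \<longlonglongrightarrow> f b - f a"
  proof -
    \<comment> \<open>The margins keep t + h, with h at most 1, in the interior, where the
      derivative of G is two-sided.\<close>
    obtain G where G: "\<And>x. x \<in> {a-1..b+2} \<Longrightarrow> (G has_vector_derivative F x) (at x within {a-1..b+2})"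
      using antiderivative_continuous[OF F_cont[of "{a-1..b+2}"]] by metis
    have G': "(G has_vector_derivative F x) (at x)" if "x \<in> {a..b+1}" for x
      using G[of x] that by (simp add: at_within_Icc_at)
    have G_quot: "(\<lambda>n. (G (x + h n) - G x) /\<^sub>R h n) \<longlonglongrightarrow> F x" if "x \<in> {a..b}" for x
      using that h0 h
      by (intro has_vector_derivative_imp_quotient_tendsto G') (auto simp: less_imp_neq[THEN not_sym])
    have int: "integral {a..b} (q n) = (G (b + h n) - G b) /\<^sub>R h n - (G (a + h n) - G a) /\<^sub>R h n" for n
    proof -
      have "((\<lambda>t. (G (t + h n) - G t) /\<^sub>R h n) has_vector_derivative q n t) (at t within {a..b})"
        if "t \<in> {a..b}" for t
      proof -
        have i: "((\<lambda>t. t + h n) has_vector_derivative 1) (at t)"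
          by (auto intro!: derivative_eq_intros)
        have j: "(G has_vector_derivative F (t + h n)) (at (t + h n))" "(G has_vector_derivative F t) (at t)"
          using that h[of n] by (auto intro!: G')
        have "((\<lambda>t. G (t + h n)) has_vector_derivative F (t + h n)) (at t)"
          using vector_diff_chain_at[OF i j(1)] by (simp add: o_def)
        then have "((\<lambda>t. G (t + h n) - G t) has_vector_derivative F (t + h n) - F t) (at t)"
          by (rule has_vector_derivative_diff[OF _ j(2)])
        then have "((\<lambda>t. (G (t + h n) - G t) /\<^sub>R h n) has_vector_derivative q n t) (at t)"
          unfolding q_def by (rule bounded_linear.has_vector_derivative[OF bounded_linear_scaleR_right])
        then show ?thesis
          by (rule has_vector_derivative_at_within)
      qed
      from fundamental_theorem_of_calculus[OF ab this] show ?thesis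
        by (simp add: has_integral_iff algebra_simps)
    qed
    show ?thesis
      unfolding int using tendsto_diff[OF G_quot[of b] G_quot[of a]] ab by (simp add: F_def)
  qed
  ultimately show ?thesis by (rule that)
qed

lemma lipschitz_ftc:
  fixes f :: "real \<Rightarrow> 'a::euclidean_space"
  assumes ab: "a \<le> b" and lip: "L-lipschitz_on {a..b} f"
    and deriv: "AE t in lebesgue_on {a..b}. (f has_vector_derivative f' t) (at t within {a..b})"
  shows "integrable (lebesgue_on {a..b}) f'" "(LINT t|lebesgue_on {a..b}. f' t) = f b - f a"
proof -
  obtain q where q: "\<And>n. continuous_on UNIV (q n)" "\<And>n t. norm (q n t) \<le> L"
    "AE t in lebesgue_on {a..b}. (\<lambda>n. q n t) \<longlonglongrightarrow> f' t"
    "(\<lambda>n. integral {a..b} (q n)) \<longlonglongrightarrow> f b - f a"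
    by (rule lipschitz_difference_quotients[OF assms]) (rule that)
  have int: "integrable (lebesgue_on {a..b}) (q n)" for n
    using q(1) by (intro continuous_imp_integrable_real) (auto intro: continuous_on_subset)
  have w: "integrable (lebesgue_on {a..b}) (\<lambda>_. L)"
    by (intro continuous_imp_integrable_real) auto
  have meas: "f' \<in> borel_measurable (lebesgue_on {a..b})"
  proof -
    have sets: "{a..b} \<in> sets lebesgue" by auto
    \<comment> \<open>Extension by zero moves the question to the complete measure
      \<open>lebesgue\<close>, where an almost everywhere limit of measurable functions is
      measurable.\<close>
    let ?s = "\<lambda>n t. if t \<in> {a..b} then q n t else 0"
    have s: "?s n \<in> borel_measurable lebesgue" for n
      using borel_measurable_integrable[OF int[of n]] borel_measurable_if[OF sets] by blast
    have "(\<lambda>t. lim (\<lambda>n. ?s n t)) \<in> borel_measurable lebesgue"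
      by (rule borel_measurable_lim_metric[OF s])
    moreover have "AE t in lebesgue. t \<in> {a..b} \<longrightarrow> (\<lambda>n. q n t) \<longlonglongrightarrow> f' t"
      using q(3) sets by (simp add: AE_restrict_space_iff)
    then have "AE t in lebesgue. lim (\<lambda>n. ?s n t) = (if t \<in> {a..b} then f' t else 0)"
      by eventually_elim (auto intro: limI)
    ultimately have "(\<lambda>t. if t \<in> {a..b} then f' t else 0) \<in> borel_measurable lebesgue"
      by (rule borel_measurable_AE)
    then show ?thesis
      using borel_measurable_if[OF sets] by blast
  qed
  note dc = meas borel_measurable_integrable[OF int] w q(3) always_eventually[OF allI[OF q(2)]]
  show "integrable (lebesgue_on {a..b}) f'"
    by (rule integrable_dominated_convergence[OF dc])
  have "(\<lambda>n. LINT t|lebesgue_on {a..b}. q n t) \<longlonglongrightarrow> (LINT t|lebesgue_on {a..b}. f' t)"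
    by (rule integral_dominated_convergence[OF dc])
  moreover have "(LINT t|lebesgue_on {a..b}. q n t) = integral {a..b} (q n)" for n
    by (rule lebesgue_integral_eq_integral[OF int]) auto
  ultimately show "(LINT t|lebesgue_on {a..b}. f' t) = f b - f a"
    using q(4) LIMSEQ_unique by auto
qed

lemma lipschitz_speed_approx:
  fixes f :: "real \<Rightarrow> 'a::euclidean_space"
  assumes ab: "a \<le> b" and lip: "L-lipschitz_on {a..b} f"
    and deriv: "AE t in lebesgue_on {a..b}. (f has_vector_derivative f' t) (at t within {a..b})"
    and "\<epsilon> > 0"
  obtains v where "continuous_on UNIV v" "\<And>t. v t > 0"
    "(LINT t|lebesgue_on {a..b}. \<bar>v t - norm (f' t)\<bar>) < \<epsilon>"
proof -
  obtain q where q: "\<And>n. continuous_on UNIV (q n)" "\<And>n t. norm (q n t) \<le> L"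
    "AE t in lebesgue_on {a..b}. (\<lambda>n. q n t) \<longlonglongrightarrow> f' t"
    using lipschitz_difference_quotients[OF ab lip deriv] by metis
  have f'_int: "integrable (lebesgue_on {a..b}) f'"
    by (rule lipschitz_ftc[OF ab lip deriv])
  \<comment> \<open>The speed may vanish. The extra summand makes the weight positive, and with it
    the total V by which the angle is normalised.\<close>
  define v where "v n t = norm (q n t) + 1 / real (Suc n)" for n t
  have v: "continuous_on UNIV (v n)" "v n t > 0" for n t
    unfolding v_def by (auto intro!: continuous_intros q add_nonneg_pos)
  have "(\<lambda>n. LINT t|lebesgue_on {a..b}. \<bar>v n t - norm (f' t)\<bar>) \<longlonglongrightarrow> (LINT t|lebesgue_on {a..b}. 0)"
  proof (rule integral_dominated_convergence)
    show "integrable (lebesgue_on {a..b}) (\<lambda>t. (L + 1) + norm (f' t))"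
      by (intro Bochner_Integration.integrable_add integrable_norm f'_int continuous_imp_integrable_real) auto
    show "(\<lambda>t. \<bar>v n t - norm (f' t)\<bar>) \<in> borel_measurable (lebesgue_on {a..b})" for n
      by (intro borel_measurable_integrable integrable_abs Bochner_Integration.integrable_diff
          integrable_norm f'_int continuous_imp_integrable_real continuous_on_subset[OF v(1)]) auto
    show "AE t in lebesgue_on {a..b}. (\<lambda>n. \<bar>v n t - norm (f' t)\<bar>) \<longlonglongrightarrow> 0"
      using q(3)
    proof eventually_elim
      case (elim t)
      have "(\<lambda>n. v n t) \<longlonglongrightarrow> norm (f' t) + 0"
        unfolding v_def using LIMSEQ_inverse_real_of_nat
        by (intro tendsto_add tendsto_norm elim) (simp add: inverse_eq_divide)
      then show ?case
        by (simp add: LIM_zero tendsto_rabs_zero)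
    qed
    show "AE t in lebesgue_on {a..b}. norm \<bar>v n t - norm (f' t)\<bar> \<le> L + 1 + norm (f' t)" for n
    proof (rule AE_I2)
      fix t
      have "v n t \<le> L + 1"
        unfolding v_def by (intro add_mono q) (auto simp: divide_simps)
      with v(2)[of n t] show "norm \<bar>v n t - norm (f' t)\<bar> \<le> L + 1 + norm (f' t)"
        using norm_ge_zero[of "f' t"] by (simp del: norm_ge_zero)
    qed
  qed auto
  then obtain n where "(LINT t|lebesgue_on {a..b}. \<bar>v n t - norm (f' t)\<bar>) < \<epsilon>"
    using \<open>\<epsilon> > 0\<close> order_tendstoD(2)[of _ 0 sequentially \<epsilon>] eventually_happens'[OF sequentially_bot]
    by force
  with v show ?thesis using that by blast
qed

lemma lipschitz_on_vector_derivative_bound: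
  fixes f :: "real \<Rightarrow> 'a::real_normed_vector"
  assumes "\<And>t. t \<in> {a..b} \<Longrightarrow> (f has_vector_derivative f' t) (at t within {a..b})"
    "\<And>t. t \<in> {a..b} \<Longrightarrow> norm (f' t) \<le> C" "0 \<le> C"
  shows "C-lipschitz_on {a..b} f"
proof (rule bounded_derivative_imp_lipschitz)
  show "(f has_derivative (\<lambda>x. x *\<^sub>R f' t)) (at t within {a..b})" if "t \<in> {a..b}" for t
    using assms(1)[OF that] by (simp add: has_vector_derivative_def)
  show "onorm (\<lambda>x. x *\<^sub>R f' t) \<le> C" if "t \<in> {a..b}" for t
    using assms(2)[OF that] by (simp add: onorm_scaleR_left onorm_id bounded_linear_ident
        onorm_scaleR_left[of "\<lambda>x. x", simplified])
qed (use assms in auto)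

section \<open>Lower bound for the length\<close>

lemma lipschitz_on_arcsin:
  assumes "0 < y" "y < pi / 2"
  shows "\<exists>C. C-lipschitz_on {- sin y..sin y} arcsin"
proof -
  have sin: "0 < sin y" "sin y < 1"
    using assms sin_monotone_2pi[of y "pi/2"] by (auto simp: sin_gt_zero)
  have bnd: "x\<^sup>2 \<le> (sin y)\<^sup>2" if "x \<in> {- sin y..sin y}" for x
    using that by (intro power2_le_iff_abs_le[THEN iffD2]) (auto simp: abs_le_iff)
  have sin2: "(sin y)\<^sup>2 < 1"
    using sin by (simp add: power_less_one_iff)
  have "(1 / sqrt (1 - (sin y)\<^sup>2))-lipschitz_on {- sin y..sin y} arcsin"
  proof (rule lipschitz_on_vector_derivative_bound)
    fix x assume x: "x \<in> {- sin y..sin y}"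
    then have "-1 < x" "x < 1" using sin by auto
    then have "(arcsin has_real_derivative inverse (sqrt (1 - x\<^sup>2))) (at x)"
      by (rule DERIV_arcsin)
    then show "(arcsin has_vector_derivative inverse (sqrt (1 - x\<^sup>2))) (at x within {- sin y..sin y})"
      by (simp add: has_real_derivative_iff_has_vector_derivative has_vector_derivative_at_within)
    show "norm (inverse (sqrt (1 - x\<^sup>2))) \<le> 1 / sqrt (1 - (sin y)\<^sup>2)"
      using bnd[OF x] sin2 by (simp add: inverse_eq_divide frac_le)
  qed (use sin2 in auto)
  then show ?thesis by blast
qed

text \<open>Lagrange's identity: the two squares differ by (a q - b p)^2.\<close>

lemma cauchy_schwarz_2: "\<bar>a * p + b * q\<bar> \<le> sqrt (a\<^sup>2 + b\<^sup>2) * sqrt (p\<^sup>2 + q\<^sup>2)" for a b p q :: real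
proof -
  have "(a * p + b * q)\<^sup>2 \<le> (a\<^sup>2 + b\<^sup>2) * (p\<^sup>2 + q\<^sup>2)"
    using zero_le_power2[of "a * q - b * p"] by (simp add: power2_eq_square algebra_simps)
  then show ?thesis
    by (metis real_le_rsqrt real_sqrt_abs real_sqrt_le_iff real_sqrt_mult)
qed

text \<open>The weight v takes the place of the speed W in the angle. For v = W the integrand would
  be a constant multiple of W; by Minkowski's inequality this proportional angle makes the right
  side smallest among all angles growing from 0 to m, so it gives the strongest bound.\<close>

lemma rotating_frame_bound:
  fixes A A' :: "real \<Rightarrow> complex"
  assumes T: "0 < T" and lip: "L-lipschitz_on {0..T} A"
    and deriv: "AE t in lebesgue_on {0..T}. (A has_vector_derivative A' t) (at t within {0..T})
      \<and> cmod (A' t) \<le> W t / 2 * sqrt (1 - (cmod (A t))\<^sup>2)"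
    and disc: "\<And>t. t \<in> {0..T} \<Longrightarrow> cmod (A t) \<le> 1"
    and ends: "A 0 = 1" "A T = cis (pi - m)"
    and W: "integrable (lebesgue_on {0..T}) W"
    and v: "continuous_on UNIV v" "\<And>t. v t > 0"
    and V_def: "V = integral {0..T} v"
  shows "pi \<le> (LINT t|lebesgue_on {0..T}. sqrt ((W t / 2)\<^sup>2 + (m * v t / V)\<^sup>2))"
proof -
  define S where "S t = sqrt ((W t / 2)\<^sup>2 + (m * v t / V)\<^sup>2)" for t
  define \<mu> where "\<mu> t = m / V * integral {0..t} v" for t
  have v_on: "continuous_on X v" for X
    using v(1) continuous_on_subset by blast
  have Vpos: "V > 0"
  proof -
    obtain x where "\<And>t. t \<in> {0..T} \<Longrightarrow> v x \<le> v t"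
      using continuous_attains_inf[OF compact_Icc _ v_on, of 0 T] T by force
    then have "integral {0..T} (\<lambda>_. v x) \<le> integral {0..T} v"
      by (intro integral_le integrable_continuous_real v_on) auto
    moreover have "0 < T * v x" using T v(2) by simp
    ultimately show ?thesis using T by (simp add: V_def)
  qed
  have \<mu>': "(\<mu> has_vector_derivative m * v t / V) (at t within {0..T})" if "t \<in> {0..T}" for t
    unfolding \<mu>_def using integral_has_vector_derivative[OF v_on that]
      by (auto intro!: derivative_eq_intros)
  have cis': "((\<lambda>t. cis (\<mu> t)) has_vector_derivative (m * v t / V) *\<^sub>R (\<i> * cis (\<mu> t))) (at t within {0..T})"
    if "t \<in> {0..T}" for t
    using has_derivative_cis[OF \<mu>'[OF that, unfolded has_vector_derivative_def]]
    by (simp add: has_vector_derivative_def)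
  have mv_int: "integrable (lebesgue_on {0..T}) (\<lambda>t. \<bar>m * v t / V\<bar>)"
    by (intro continuous_imp_integrable_real continuous_intros v_on) (use Vpos in auto)
  have S_int: "integrable (lebesgue_on {0..T}) S"
  proof (rule Bochner_Integration.integrable_bound)
    show "integrable (lebesgue_on {0..T}) (\<lambda>t. \<bar>W t / 2\<bar> + \<bar>m * v t / V\<bar>)"
      by (intro Bochner_Integration.integrable_add mv_int) (use W in simp)
    have "(\<lambda>t. m * v t / V) \<in> borel_measurable (lebesgue_on {0..T})"
      by (intro borel_measurable_integrable continuous_imp_integrable_real continuous_intros v_on) (use Vpos in auto)
    then show "S \<in> borel_measurable (lebesgue_on {0..T})"
      unfolding S_def using borel_measurable_integrable[OF W] by measurable
    show "AE t in lebesgue_on {0..T}. norm (S t) \<le> norm (\<bar>W t / 2\<bar> + \<bar>m * v t / V\<bar>)"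
    proof (rule AE_I2)
      fix t
      show "norm (S t) \<le> norm (\<bar>W t / 2\<bar> + \<bar>m * v t / V\<bar>)"
        using sqrt_sum_squares_le_sum_abs[of "W t / 2" "m * v t / V"] by (simp add: S_def)
    qed
  qed
  have main: "2 * y \<le> integral\<^sup>L (lebesgue_on {0..T}) S" if y: "0 < y" "y < pi / 2" for y
  proof -
    \<comment> \<open>The factor \<open>\<eta> < 1\<close> keeps the argument of \<open>arcsin\<close> in a range on which it is Lipschitz.\<close>
    define \<eta> where "\<eta> = sin y"
    have \<eta>: "0 < \<eta>" "\<eta> < 1"
      using y sin_monotone_2pi[of y "pi/2"] by (auto simp: sin_gt_zero \<eta>_def)
    define z where "z t = A t * cis (\<mu> t)" for t
    define z' where "z' t = A' t * cis (\<mu> t) + A t * ((m * v t / V) *\<^sub>R (\<i> * cis (\<mu> t)))" for t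
    define h where "h t = arcsin (\<eta> * Re (z t))" for t
    define h' where "h' t = \<eta> * Re (z' t) / sqrt (1 - (\<eta> * Re (z t))\<^sup>2)" for t
    have z_le: "cmod (z t) \<le> 1" if "t \<in> {0..T}" for t
      using disc[OF that] by (simp add: z_def norm_mult)
    have r_le: "\<bar>Re (z t)\<bar> \<le> 1" if "t \<in> {0..T}" for t
      using z_le[OF that] abs_Re_le_cmod[of "z t"] by simp
    have \<eta>r: "\<bar>\<eta> * Re (z t)\<bar> \<le> \<eta>" if "t \<in> {0..T}" for t
      using r_le[OF that] \<eta> by (simp add: abs_mult mult_left_le)
    obtain K where K: "\<And>t. t \<in> {0..T} \<Longrightarrow> norm (m * v t / V) \<le> K"
      using continuous_attains_sup[of "{0..T}" "\<lambda>t. norm (m * v t / V)"] T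
      by (force intro!: continuous_intros v_on)
    have K0: "0 \<le> K"
      using K[of 0] T by (smt (verit) atLeastAtMost_iff norm_ge_zero)
    have cis_lip: "K-lipschitz_on {0..T} (\<lambda>t. cis (\<mu> t))"
      by (rule lipschitz_on_vector_derivative_bound[OF cis' _ K0]) (use K in \<open>auto simp: norm_mult\<close>)
    have z_lip: "(L + K)-lipschitz_on {0..T} z"
    proof (rule lipschitz_onI)
      fix s t assume st: "s \<in> {0..T}" "t \<in> {0..T}"
      have "z s - z t = (A s - A t) * cis (\<mu> s) + A t * (cis (\<mu> s) - cis (\<mu> t))"
        by (simp add: z_def algebra_simps)
      then have "cmod (z s - z t) \<le> cmod (A s - A t) + cmod (A t) * cmod (cis (\<mu> s) - cis (\<mu> t))"
        by (metis norm_cis norm_mult mult.right_neutral norm_triangle_ineq)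
      also have "\<dots> \<le> cmod (A s - A t) + cmod (cis (\<mu> s) - cis (\<mu> t))"
        using disc[OF st(2)] by (simp add: mult_left_le_one_le)
      also have "\<dots> \<le> L * dist s t + K * dist s t"
        using lipschitz_onD[OF lip st] lipschitz_onD[OF cis_lip st] by (simp add: dist_norm)
      finally show "dist (z s) (z t) \<le> (L + K) * dist s t"
        by (simp add: dist_norm algebra_simps)
    qed (use K0 lipschitz_on_nonneg[OF lip] in auto)
    obtain C where C: "C-lipschitz_on {- \<eta>..\<eta>} arcsin"
      using lipschitz_on_arcsin[OF y] unfolding \<eta>_def by blast
    have h_lip: "(C * (L + K))-lipschitz_on {0..T} h"
    proof (rule lipschitz_onI)
      fix s t assume st: "s \<in> {0..T}" "t \<in> {0..T}"
      have "dist (h s) (h t) \<le> C * dist (\<eta> * Re (z s)) (\<eta> * Re (z t))"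
        unfolding h_def using \<eta>r[OF st(1)] \<eta>r[OF st(2)] by (intro lipschitz_onD[OF C]) auto
      also have "dist (\<eta> * Re (z s)) (\<eta> * Re (z t)) = \<eta> * \<bar>Re (z s - z t)\<bar>"
        using \<eta> by (simp add: dist_real_def abs_mult flip: right_diff_distrib)
      also have "C * (\<eta> * \<bar>Re (z s - z t)\<bar>) \<le> C * (1 * cmod (z s - z t))"
        using \<eta> by (intro mult_left_mono mult_mono abs_Re_le_cmod lipschitz_on_nonneg[OF C]) auto
      also have "\<dots> \<le> C * ((L + K) * dist s t)"
        using lipschitz_onD[OF z_lip st] by (intro mult_left_mono lipschitz_on_nonneg[OF C]) (simp add: dist_norm)
      finally show "dist (h s) (h t) \<le> C * (L + K) * dist s t"
        by (simp add: mult.assoc)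
    qed (use K0 lipschitz_on_nonneg[OF lip] lipschitz_on_nonneg[OF C] in auto)
    have AE_in: "AE t in lebesgue_on {0..T}. t \<in> {0..T}"
      by (rule AE_I2) simp
    have h_deriv: "AE t in lebesgue_on {0..T}. (h has_vector_derivative h' t) (at t within {0..T})"
      using deriv AE_in
    proof eventually_elim
      case (elim t)
      then have "(z has_vector_derivative z' t) (at t within {0..T})"
        unfolding z_def z'_def by (auto intro!: derivative_eq_intros cis' simp: algebra_simps)
      then have r': "((\<lambda>t. \<eta> * Re (z t)) has_real_derivative \<eta> * Re (z' t)) (at t within {0..T})"
        unfolding has_real_derivative_iff_has_vector_derivative
        by (intro has_vector_derivative_mult_right bounded_linear.has_vector_derivative[OF bounded_linear_Re])
      have "\<bar>\<eta> * Re (z t)\<bar> < 1"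
        using \<eta>r[OF elim(2)] \<eta> by linarith
      then have "(arcsin has_real_derivative inverse (sqrt (1 - (\<eta> * Re (z t))\<^sup>2))) (at (\<eta> * Re (z t)))"
        by (intro DERIV_arcsin) auto
      from DERIV_chain2[OF this r'] show ?case
        unfolding h_def h'_def has_real_derivative_iff_has_vector_derivative
        by (simp add: divide_inverse mult.commute)
    qed
    have h'_le: "AE t in lebesgue_on {0..T}. - h' t \<le> S t"
      using deriv AE_in
    proof eventually_elim
      case (elim t)
      let ?a = "Re (A' t * cis (\<mu> t))" and ?r = "Re (z t)" and ?q = "Im (z t)"
      have zz: "?r\<^sup>2 + ?q\<^sup>2 = (cmod (A t))\<^sup>2"
        using cmod_power2[of "z t"] by (simp only: z_def norm_mult norm_cis mult_1_right)
      have p0: "0 \<le> 1 - (cmod (A t))\<^sup>2"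
        using disc[OF elim(2)] by (simp add: power_le_one)
      have Re_z': "Re (z' t) = ?a - (m * v t / V) * ?q"
        by (simp add: z'_def z_def algebra_simps)
      have "\<bar>?a\<bar> \<le> W t / 2 * sqrt (1 - (cmod (A t))\<^sup>2)"
        using elim(1) abs_Re_le_cmod[of "A' t * cis (\<mu> t)"] by (simp add: norm_mult)
      then have "\<bar>Re (z' t)\<bar> \<le> W t / 2 * sqrt (1 - (cmod (A t))\<^sup>2) + \<bar>m * v t / V\<bar> * \<bar>?q\<bar>"
        unfolding Re_z' using abs_triangle_ineq4[of ?a "(m * v t / V) * ?q"] unfolding abs_mult[of "m * v t / V"]
        by (meson add_right_mono order_trans)
      \<comment> \<open>Cauchy-Schwarz for the pair of half speed and angular speed against (|b|,
        |Im z|), where |b|^2 = 1 - |a|^2. The second vector has squared length 1 - (Re z)^2.\<close>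
      also have "\<dots> \<le> S t * sqrt ((sqrt (1 - (cmod (A t))\<^sup>2))\<^sup>2 + \<bar>?q\<bar>\<^sup>2)"
        using cauchy_schwarz_2[of "W t / 2" "sqrt (1 - (cmod (A t))\<^sup>2)" "\<bar>m * v t / V\<bar>" "\<bar>?q\<bar>"]
        unfolding S_def by (simp only: power2_abs)
      also have "(sqrt (1 - (cmod (A t))\<^sup>2))\<^sup>2 + \<bar>?q\<bar>\<^sup>2 = 1 - ?r\<^sup>2"
        using p0 zz by simp
      finally have z'_le: "\<bar>Re (z' t)\<bar> \<le> S t * sqrt (1 - ?r\<^sup>2)" .
      have S0: "0 \<le> S t" by (simp add: S_def)
      have r2: "?r\<^sup>2 \<le> 1" using r_le[OF elim(2)] by (simp add: abs_square_le_1)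
      have \<eta>2: "\<eta>\<^sup>2 < 1" using \<eta> by (simp add: power_less_one_iff)
      have D: "0 < 1 - (\<eta> * ?r)\<^sup>2"
        using \<eta>2 r2 mult_left_le[of "?r\<^sup>2" "\<eta>\<^sup>2"] by (simp add: power_mult_distrib)
      \<comment> \<open>Passing to the scaled real part loses nothing of the form of the bound, as
        \<eta>^2 (1 - r^2) \<le> 1 - (\<eta> r)^2 for \<eta> < 1.\<close>
      have "\<eta> * \<bar>Re (z' t)\<bar> \<le> \<eta> * (S t * sqrt (1 - ?r\<^sup>2))"
        using z'_le \<eta> by (intro mult_left_mono) auto
      also have "\<dots> = S t * sqrt (\<eta>\<^sup>2 * (1 - ?r\<^sup>2))"
        using \<eta> by (simp add: real_sqrt_mult)
      also have "\<dots> \<le> S t * sqrt (1 - (\<eta> * ?r)\<^sup>2)"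
        using \<eta>2 S0 by (intro mult_left_mono) (simp_all add: power_mult_distrib algebra_simps)
      finally have "\<bar>\<eta> * Re (z' t)\<bar> \<le> S t * sqrt (1 - (\<eta> * ?r)\<^sup>2)"
        using \<eta> by (simp add: abs_mult)
      then have "- (\<eta> * Re (z' t)) \<le> S t * sqrt (1 - (\<eta> * ?r)\<^sup>2)" by linarith
      then show ?case
        using D by (simp add: h'_def minus_divide_left pos_divide_le_eq del: minus_divide_left[symmetric])
    qed
    note ftc = lipschitz_ftc[OF less_imp_le[OF T] h_lip h_deriv]
    have arcsin_\<eta>: "arcsin \<eta> = y"
      unfolding \<eta>_def using y by (intro arcsin_sin) auto
    have "z 0 = 1"
      by (simp add: z_def \<mu>_def ends)
    then have h0: "h 0 = y"
      by (simp add: h_def arcsin_\<eta>)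
    have "\<mu> T = m"
      using Vpos by (simp add: \<mu>_def V_def)
    then have "z T = -1"
      by (simp add: z_def ends cis_mult)
    then have hT: "h T = - y"
      using \<eta> by (simp add: h_def arcsin_minus arcsin_\<eta>)
    have "(LINT t|lebesgue_on {0..T}. - h' t) \<le> integral\<^sup>L (lebesgue_on {0..T}) S"
      by (rule integral_mono_AE[OF _ S_int h'_le]) (use ftc(1) in simp)
    with ftc(2) show ?thesis
      by (simp add: h0 hT)
  qed
  \<comment> \<open>The bound 2 y comes from the scaled path, which runs from sin y to - sin y; now
    y tends to pi/2.\<close>
  have "pi / 2 \<le> integral\<^sup>L (lebesgue_on {0..T}) S / 2"
  proof (rule dense_le_bounded[of 0])
    show "y \<le> integral\<^sup>L (lebesgue_on {0..T}) S / 2" if "0 < y" "y < pi / 2" for y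
      using main[OF that] by simp
  qed simp
  then show ?thesis
    by (simp add: S_def[abs_def])
qed

lemma disc_path_length_lower_bound:
  fixes A A' :: "real \<Rightarrow> complex"
  assumes T: "0 < T" and lip: "L-lipschitz_on {0..T} A"
    and deriv: "AE t in lebesgue_on {0..T}. (A has_vector_derivative A' t) (at t within {0..T})
      \<and> cmod (A' t) \<le> W t / 2 * sqrt (1 - (cmod (A t))\<^sup>2)"
    and disc: "\<And>t. t \<in> {0..T} \<Longrightarrow> cmod (A t) \<le> 1"
    and ends: "A 0 = 1" "A T = cis (pi - m)" and m: "\<bar>m\<bar> < pi"
    and W: "integrable (lebesgue_on {0..T}) W" "\<And>t. W t \<ge> 0"
    and approx: "\<And>\<epsilon>. \<epsilon> > 0 \<Longrightarrow> \<exists>v. continuous_on UNIV v \<and> (\<forall>t. v t > 0) \<and>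
      (LINT t|lebesgue_on {0..T}. \<bar>v t - W t\<bar>) < \<epsilon>"
  shows "2 * sqrt (pi\<^sup>2 - m\<^sup>2) \<le> (LINT t|lebesgue_on {0..T}. W t)"
proof -
  define I where "I = (LINT t|lebesgue_on {0..T}. W t)"
  have "\<exists>v. continuous_on UNIV v \<and> (\<forall>t. v t > 0) \<and>
      (LINT t|lebesgue_on {0..T}. \<bar>v t - W t\<bar>) < 1 / real (Suc n)" for n
    by (rule approx) simp
  then obtain v where v: "\<And>n. continuous_on UNIV (v n)" "\<And>n t. v n t > 0"
      "\<And>n. (LINT t|lebesgue_on {0..T}. \<bar>v n t - W t\<bar>) < 1 / real (Suc n)"
    by metis
  define V where "V n = integral {0..T} (v n)" for n
  define e where "e n = (LINT t|lebesgue_on {0..T}. \<bar>v n t - W t\<bar>)" for n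
  have v_int: "integrable (lebesgue_on {0..T}) (v n)" for n
    by (intro continuous_imp_integrable_real continuous_on_subset[OF v(1)]) auto
  have V_eq: "V n = (LINT t|lebesgue_on {0..T}. v n t)" for n
    unfolding V_def by (rule lebesgue_integral_eq_integral[symmetric, OF v_int]) simp
  have V0: "V n \<ge> 0" for n
    unfolding V_eq using v(2) by (intro integral_nonneg_AE) (auto intro: less_imp_le)
  have diff_int: "integrable (lebesgue_on {0..T}) (\<lambda>t. \<bar>v n t - W t\<bar>)" for n
    by (intro integrable_abs Bochner_Integration.integrable_diff v_int W)
  have e: "0 \<le> e n" "e n \<le> 1 / real (Suc n)" for n
    unfolding e_def using v(3)[of n] by (auto intro!: integral_nonneg_AE)
  have "\<bar>V n - I\<bar> \<le> e n" for n
  proof -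
    have "V n - I = (LINT t|lebesgue_on {0..T}. v n t - W t)"
      unfolding V_eq I_def by (rule Bochner_Integration.integral_diff[symmetric, OF v_int W(1)])
    then show ?thesis
      using integral_abs_bound[of "lebesgue_on {0..T}" "\<lambda>t. v n t - W t"] by (simp add: e_def)
  qed
  then have VI: "\<bar>V n - I\<bar> \<le> 1 / real (Suc n)" for n
    using e(2) order_trans by blast
  have n0: "(\<lambda>n. 1 / real (Suc n)) \<longlonglongrightarrow> 0"
    using LIMSEQ_inverse_real_of_nat by (simp add: inverse_eq_divide)
  have e_lim: "e \<longlonglongrightarrow> 0"
    by (rule tendsto_sandwich[OF _ _ tendsto_const n0]) (use e in auto)
  have V_lim: "V \<longlonglongrightarrow> I"
    by (rule LIM_zero_cancel, rule Lim_null_comparison[OF _ n0]) (use VI in auto)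
  define S where "S n t = sqrt ((W t / 2)\<^sup>2 + (m * v n t / V n)\<^sup>2)" for n t
  have pi_le: "pi \<le> (LINT t|lebesgue_on {0..T}. S n t)" for n
    unfolding S_def by (rule rotating_frame_bound[OF T lip deriv disc ends W(1) v(1,2) V_def])
  \<comment> \<open>The limit of m / V n requires a nonzero I. Bounding the root by the sum of the
    absolute values and integrating gives pi \<le> I/2 + |m|, while |m| < pi.\<close>
  have I_pos: "0 < I"
  proof -
    have "(LINT t|lebesgue_on {0..T}. S 0 t) \<le> (LINT t|lebesgue_on {0..T}. W t / 2 + \<bar>m\<bar> / V 0 * v 0 t)"
    proof (rule integral_mono')
      show "integrable (lebesgue_on {0..T}) (\<lambda>t. W t / 2 + \<bar>m\<bar> / V 0 * v 0 t)"
        by (intro Bochner_Integration.integrable_add integrable_divide integrable_mult_right W v_int)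
      show "S 0 t \<le> W t / 2 + \<bar>m\<bar> / V 0 * v 0 t" for t
        using sqrt_sum_squares_le_sum_abs[of "W t / 2" "m * v 0 t / V 0"] W(2)[of t] v(2)[of 0 t] V0[of 0]
        by (simp add: S_def abs_mult)
    qed (use W(2) v(2) V0 in \<open>auto simp: less_imp_le\<close>)
    also have "\<dots> = I / 2 + \<bar>m\<bar> / V 0 * V 0"
      unfolding V_eq I_def using W(1) v_int[of 0] by (simp add: V_eq)
    \<comment> \<open>Only an inequality: \<open>V 0\<close> is merely known to be nonnegative here,
      and division by zero yields 0.\<close>
    also have "\<dots> \<le> I / 2 + \<bar>m\<bar>"
      using V0[of 0] by simp
    finally show ?thesis
      using pi_le[of 0] m by linarith
  qed
  have step: "pi \<le> I * sqrt (1 / 4 + (m / V n)\<^sup>2) + \<bar>m\<bar> / V n * e n" for n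
  proof -
    have "(LINT t|lebesgue_on {0..T}. S n t)
        \<le> (LINT t|lebesgue_on {0..T}. W t * sqrt (1 / 4 + (m / V n)\<^sup>2) + \<bar>m\<bar> / V n * \<bar>v n t - W t\<bar>)"
    proof (rule integral_mono')
      show "integrable (lebesgue_on {0..T}) (\<lambda>t. W t * sqrt (1 / 4 + (m / V n)\<^sup>2) + \<bar>m\<bar> / V n * \<bar>v n t - W t\<bar>)"
        by (intro Bochner_Integration.integrable_add integrable_mult_left integrable_mult_right W diff_int)
      show "S n t \<le> W t * sqrt (1 / 4 + (m / V n)\<^sup>2) + \<bar>m\<bar> / V n * \<bar>v n t - W t\<bar>" for t
      proof -
        \<comment> \<open>Triangle inequality in the plane: exchanging v for W in the second
          coordinate costs |m| / V times |v - W|, whose integral tends to 0. What remains is a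
          constant multiple of W.\<close>
        have "S n t \<le> sqrt ((W t / 2)\<^sup>2 + (m / V n * W t)\<^sup>2) + sqrt (0\<^sup>2 + (m / V n * (v n t - W t))\<^sup>2)"
          using real_sqrt_sum_squares_triangle_ineq[of "W t / 2" 0 "m / V n * W t" "m / V n * (v n t - W t)"]
          by (simp add: S_def algebra_simps)
        also have "(W t / 2)\<^sup>2 + (m / V n * W t)\<^sup>2 = (W t)\<^sup>2 * (1 / 4 + (m / V n)\<^sup>2)"
          by (simp add: power_mult_distrib power_divide algebra_simps)
        finally show ?thesis
          using W(2)[of t] V0[of n] by (simp add: real_sqrt_mult abs_mult)
      qed
    qed (use W(2) V0 in \<open>auto simp: less_imp_le\<close>)
    also have "\<dots> = I * sqrt (1 / 4 + (m / V n)\<^sup>2) + \<bar>m\<bar> / V n * e n"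
      unfolding e_def I_def using W(1) diff_int[of n] by simp
    finally show ?thesis using pi_le[of n] by linarith
  qed
  have "(\<lambda>n. I * sqrt (1 / 4 + (m / V n)\<^sup>2) + \<bar>m\<bar> / V n * e n)
      \<longlonglongrightarrow> I * sqrt (1 / 4 + (m / I)\<^sup>2) + \<bar>m\<bar> / I * 0"
    using I_pos by (intro tendsto_intros V_lim e_lim) auto
  then have "pi \<le> I * sqrt (1 / 4 + (m / I)\<^sup>2)"
    using step LIMSEQ_le_const by fastforce
  also have "\<dots> = sqrt (I\<^sup>2 * (1 / 4 + (m / I)\<^sup>2))"
    using I_pos by (simp add: real_sqrt_mult)
  also have "I\<^sup>2 * (1 / 4 + (m / I)\<^sup>2) = I\<^sup>2 / 4 + m\<^sup>2"
    using I_pos by (simp add: power_divide distrib_left)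
  finally have "pi\<^sup>2 \<le> I\<^sup>2 / 4 + m\<^sup>2"
    by (smt (verit) pi_gt_zero real_sqrt_le_iff real_sqrt_unique sqrt_le_D)
  then have "(2 * sqrt (pi\<^sup>2 - m\<^sup>2))\<^sup>2 \<le> I\<^sup>2"
    using m abs_le_square_iff[of m pi] by (simp add: power_mult_distrib)
  then show ?thesis
    unfolding I_def[symmetric] by (rule power2_le_imp_le) (use I_pos in auto)
qed

section \<open>From horizontal curves to paths of the first entry in the disc\<close>

lemma borel_measurable_lebesgue_on_AE:
  fixes f g :: "'a::euclidean_space \<Rightarrow> 'b::euclidean_space"
  assumes f: "f \<in> borel_measurable (lebesgue_on S)" and S: "S \<in> sets lebesgue"
    and eq: "AE x in lebesgue_on S. f x = g x"
  shows "g \<in> borel_measurable (lebesgue_on S)"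
proof -
  have "AE x in lebesgue. x \<in> S \<longrightarrow> f x = g x"
    using eq S by (simp add: AE_restrict_space_iff)
  then have "AE x in lebesgue. (if x \<in> S then f x else 0) = (if x \<in> S then g x else 0)"
    by eventually_elim auto
  with borel_measurable_if_I[OF f S] show ?thesis
    by (rule borel_measurable_if_D[OF borel_measurable_AE])
qed

text \<open>Everything is read off from the control w: the first entry has derivative -(b cnj w)/2,
  the sub-Riemannian speed is |w|, and the Euclidean norm of the derivative is |w| / sqrt 2.
  Expressing |w| by the norm makes it a function of t to which the results on Lipschitz curves
  apply.\<close>

lemma horizontal_derivative:
  assumes "horizontal T \<gamma>" "0 < T"
  defines "\<gamma>' \<equiv> \<lambda>t. vector_derivative \<gamma> (at t within {0..T})"
  shows "AE t in lebesgue_on {0..T}. (\<gamma> has_vector_derivative \<gamma>' t) (at t within {0..T}) \<and>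
     cmod (\<gamma>' t $ 1 $ 1) = sqrt 2 * norm (\<gamma>' t) / 2 * sqrt (1 - (cmod (\<gamma> t $ 1 $ 1))\<^sup>2) \<and>
     sqrt (sr_metric (\<gamma> t) (\<gamma>' t) (\<gamma>' t)) = sqrt 2 * norm (\<gamma>' t)"
proof -
  have "AE t in lebesgue_on {0..T}. t \<in> {0..T}"
    by (rule AE_I2) simp
  moreover have "AE t in lebesgue_on {0..T}.
        \<exists>v\<in>distribution (\<gamma> t). (\<gamma> has_vector_derivative v) (at t within {0..T})"
    using assms by (simp add: horizontal_def)
  ultimately show ?thesis
  proof eventually_elim
    case (elim t)
    then obtain v where v: "v \<in> distribution (\<gamma> t)" "(\<gamma> has_vector_derivative v) (at t within {0..T})"
      by blast
    have \<gamma>': "\<gamma>' t = v"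
      unfolding \<gamma>'_def using vector_derivative_within_cbox[of 0 T t \<gamma> v] v(2) elim assms(2) by simp
    define a b where "a = \<gamma> t $ 1 $ 1" and "b = \<gamma> t $ 1 $ 2"
    have "\<gamma> t \<in> SU2"
      using assms(1) elim by (auto simp: horizontal_def)
    then have \<gamma>: "\<gamma> t = su a b" and SU: "su a b \<in> SU2"
      using SU2_eq_su unfolding a_def b_def by auto
    have ab: "(cmod a)\<^sup>2 + (cmod b)\<^sup>2 = 1"
      using SU by (simp add: su_in_SU2_iff)
    obtain w where w: "v = su (- (b * cnj w) / 2) (a * w / 2)"
      using v(1) by (auto simp: \<gamma> distribution_su)
    have "(norm v)\<^sup>2 = ((cmod a)\<^sup>2 + (cmod b)\<^sup>2) * (cmod w)\<^sup>2 / 2"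
      unfolding w norm_su by (simp add: norm_mult norm_divide power_mult_distrib power_divide field_simps)
    then have "(cmod w)\<^sup>2 = (sqrt 2 * norm v)\<^sup>2"
      using ab by (simp add: power_mult_distrib)
    then have nw: "cmod w = sqrt 2 * norm v"
      by (rule power2_eq_imp_eq) auto
    have "cmod b = sqrt (1 - (cmod a)\<^sup>2)"
      using ab by (intro real_sqrt_unique[symmetric]) auto
    moreover have "cmod (v $ 1 $ 1) = cmod w / 2 * cmod b"
      by (simp add: w norm_mult norm_divide)
    moreover have "sqrt (sr_metric (\<gamma> t) v v) = cmod w"
      unfolding w \<gamma> sr_metric_su[OF SU] by simp
    ultimately show ?case
      unfolding \<gamma>' a_def[symmetric] nw[symmetric] using v(2) by (metis)
  qed
qed

text \<open>The disc estimate with m = pi - \<phi>. The bound equals the time at which a geodesic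
  arrives at this point of exp(k) on its first return, so it is attained.\<close>

lemma sr_length_lower_bound:
  assumes hor: "horizontal T \<gamma>" and T: "0 < T" and ends: "\<gamma> 0 = mat 1" "\<gamma> T = su (cis \<phi>) 0"
    and \<phi>: "0 < \<phi>" "\<phi> < 2 * pi"
  shows "2 * sqrt (\<phi> * (2 * pi - \<phi>)) \<le> sr_length T \<gamma>"
proof -
  define \<gamma>' where "\<gamma>' t = vector_derivative \<gamma> (at t within {0..T})" for t
  define W where "W t = sqrt 2 * norm (\<gamma>' t)" for t
  have W_norm: "norm (sqrt 2 *\<^sub>R \<gamma>' t) = W t" for t
    by (simp add: W_def)
  obtain L where L: "L-lipschitz_on {0..T} \<gamma>"
    using hor by (auto simp: horizontal_def)
  note der = horizontal_derivative[OF hor T, folded \<gamma>'_def, folded W_def]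
  have der1: "AE t in lebesgue_on {0..T}. (\<gamma> has_vector_derivative \<gamma>' t) (at t within {0..T})"
    using der by eventually_elim simp
  \<comment> \<open>Scaled by \<open>sqrt 2\<close>, the curve has Euclidean speed W, so
    integrability and approximation of W follow from the general results.\<close>
  have der2: "AE t in lebesgue_on {0..T}. ((\<lambda>t. sqrt 2 *\<^sub>R \<gamma> t) has_vector_derivative sqrt 2 *\<^sub>R \<gamma>' t) (at t within {0..T})"
    using der1 by eventually_elim (rule bounded_linear.has_vector_derivative[OF bounded_linear_scaleR_right])
  have L2: "(sqrt 2 * L)-lipschitz_on {0..T} (\<lambda>t. sqrt 2 *\<^sub>R \<gamma> t)"
    using lipschitz_on_cmult[OF L, of "sqrt 2"] by simp
  have entry: "bounded_linear (\<lambda>g::cmat2. g $ 1 $ 1)"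
    using bounded_linear_compose[OF bounded_linear_vec_nth bounded_linear_vec_nth] .
  have lipA: "L-lipschitz_on {0..T} (\<lambda>t. \<gamma> t $ 1 $ 1)"
  proof (rule lipschitz_onI)
    fix s t assume st: "s \<in> {0..T}" "t \<in> {0..T}"
    have "dist (\<gamma> s $ 1 $ 1) (\<gamma> t $ 1 $ 1) \<le> dist (\<gamma> s) (\<gamma> t)"
      by (meson dist_vec_nth_le order_trans)
    also have "\<dots> \<le> L * dist s t"
      by (rule lipschitz_onD[OF L st])
    finally show "dist (\<gamma> s $ 1 $ 1) (\<gamma> t $ 1 $ 1) \<le> L * dist s t" .
  qed (rule lipschitz_on_nonneg[OF L])
  have W_int: "integrable (lebesgue_on {0..T}) W"
    using integrable_norm[OF lipschitz_ftc(1)[OF less_imp_le[OF T] L2 der2]] by (simp only: W_norm)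
  have "2 * sqrt (pi\<^sup>2 - (pi - \<phi>)\<^sup>2) \<le> (LINT t|lebesgue_on {0..T}. W t)"
  proof (rule disc_path_length_lower_bound[OF T lipA])
    show "AE t in lebesgue_on {0..T}. ((\<lambda>t. \<gamma> t $ 1 $ 1) has_vector_derivative \<gamma>' t $ 1 $ 1) (at t within {0..T})
        \<and> cmod (\<gamma>' t $ 1 $ 1) \<le> W t / 2 * sqrt (1 - (cmod (\<gamma> t $ 1 $ 1))\<^sup>2)"
      using der by eventually_elim (auto intro: bounded_linear.has_vector_derivative[OF entry])
    show "cmod (\<gamma> t $ 1 $ 1) \<le> 1" if "t \<in> {0..T}" for t
    proof -
      have g: "\<gamma> t \<in> SU2" using hor that by (auto simp: horizontal_def)
      then have "(cmod (\<gamma> t $ 1 $ 1))\<^sup>2 + (cmod (\<gamma> t $ 1 $ 2))\<^sup>2 = 1"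
        using su_in_SU2_iff[of "\<gamma> t $ 1 $ 1" "\<gamma> t $ 1 $ 2", folded SU2_eq_su[OF g]] by blast
      then have "(cmod (\<gamma> t $ 1 $ 1))\<^sup>2 \<le> 1\<^sup>2"
        using zero_le_power2[of "cmod (\<gamma> t $ 1 $ 2)"] unfolding one_power2 by linarith
      then show ?thesis by (rule power2_le_imp_le) simp
    qed
    show "\<gamma> 0 $ 1 $ 1 = 1" by (simp add: ends mat_def)
    show "\<gamma> T $ 1 $ 1 = cis (pi - (pi - \<phi>))" by (simp add: ends)
    show "\<bar>pi - \<phi>\<bar> < pi" using \<phi> by auto
    show "integrable (lebesgue_on {0..T}) W"
      by (rule W_int)
    show "W t \<ge> 0" for t by (simp add: W_def)
    show "\<exists>v. continuous_on UNIV v \<and> (\<forall>t. v t > 0) \<and> (LINT t|lebesgue_on {0..T}. \<bar>v t - W t\<bar>) < \<epsilon>"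
      if e: "\<epsilon> > 0" for \<epsilon>
    proof -
      obtain v where "continuous_on UNIV v" "\<And>t. v t > 0"
        "(LINT t|lebesgue_on {0..T}. \<bar>v t - norm (sqrt 2 *\<^sub>R \<gamma>' t)\<bar>) < \<epsilon>"
        by (rule lipschitz_speed_approx[OF less_imp_le[OF T] L2 der2 e]) (rule that)
      then show ?thesis
        unfolding W_norm by blast
    qed
  qed
  also have "pi\<^sup>2 - (pi - \<phi>)\<^sup>2 = \<phi> * (2 * pi - \<phi>)"
    by (simp add: power2_eq_square algebra_simps)
  also have "(LINT t|lebesgue_on {0..T}. W t) = sr_length T \<gamma>"
  proof -
    let ?s = "\<lambda>t. sqrt (sr_metric (\<gamma> t) (\<gamma>' t) (\<gamma>' t))"
    have eq: "AE t in lebesgue_on {0..T}. W t = ?s t"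
      using der by eventually_elim simp
    have W: "W \<in> borel_measurable (lebesgue_on {0..T})"
      using borel_measurable_integrable[OF W_int] .
    \<comment> \<open>The length integrand contains a choice of derivative and a matrix inverse; its
      measurability is inherited from W, with which it agrees almost everywhere.\<close>
    show ?thesis
      unfolding sr_length_def Let_def \<gamma>'_def[symmetric]
      by (rule integral_cong_AE[OF W borel_measurable_lebesgue_on_AE[OF W _ eq] eq]) simp
  qed
  finally show ?thesis .
qed

section \<open>Concatenation of horizontal curves\<close>

text \<open>Horizontality in a form suited to concatenation: the finite set N absorbs corners, and a
  control in the unit disc bounds the length by the duration T. Speeds below 1 are allowed, so that
  an arc may take more time than its length.\<close>

definition reach :: "real \<Rightarrow> cmat2 \<Rightarrow> cmat2 \<Rightarrow> bool" where
  "reach T p q \<longleftrightarrow> 0 \<le> T \<and>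
     (\<exists>\<gamma> L N. finite N \<and> L-lipschitz_on {0..T} \<gamma> \<and> \<gamma> ` {0..T} \<subseteq> SU2 \<and> \<gamma> 0 = p \<and> \<gamma> T = q \<and>
       (\<forall>t\<in>{0<..<T} - N. \<exists>w. cmod w \<le> 1 \<and> (\<gamma> has_vector_derivative \<gamma> t ** su 0 (w / 2)) (at t)))"

lemma reach_trans:
  assumes "reach T\<^sub>1 p q" "reach T\<^sub>2 q r"
  shows "reach (T\<^sub>1 + T\<^sub>2) p r"
proof -
  obtain \<gamma>\<^sub>1 L\<^sub>1 N\<^sub>1 where 1: "0 \<le> T\<^sub>1" "finite N\<^sub>1" "L\<^sub>1-lipschitz_on {0..T\<^sub>1} \<gamma>\<^sub>1" "\<gamma>\<^sub>1 ` {0..T\<^sub>1} \<subseteq> SU2"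
    "\<gamma>\<^sub>1 0 = p" "\<gamma>\<^sub>1 T\<^sub>1 = q"
    "\<And>t. t \<in> {0<..<T\<^sub>1} - N\<^sub>1 \<Longrightarrow> \<exists>w. cmod w \<le> 1 \<and> (\<gamma>\<^sub>1 has_vector_derivative \<gamma>\<^sub>1 t ** su 0 (w / 2)) (at t)"
    using assms(1) unfolding reach_def by blast
  obtain \<gamma>\<^sub>2 L\<^sub>2 N\<^sub>2 where 2: "0 \<le> T\<^sub>2" "finite N\<^sub>2" "L\<^sub>2-lipschitz_on {0..T\<^sub>2} \<gamma>\<^sub>2" "\<gamma>\<^sub>2 ` {0..T\<^sub>2} \<subseteq> SU2"
    "\<gamma>\<^sub>2 0 = q" "\<gamma>\<^sub>2 T\<^sub>2 = r"
    "\<And>t. t \<in> {0<..<T\<^sub>2} - N\<^sub>2 \<Longrightarrow> \<exists>w. cmod w \<le> 1 \<and> (\<gamma>\<^sub>2 has_vector_derivative \<gamma>\<^sub>2 t ** su 0 (w / 2)) (at t)"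
    using assms(2) unfolding reach_def by blast
  define \<gamma> where "\<gamma> t = (if t \<le> T\<^sub>1 then \<gamma>\<^sub>1 t else \<gamma>\<^sub>2 (t - T\<^sub>1))" for t
  define N where "N = N\<^sub>1 \<union> insert T\<^sub>1 ((\<lambda>t. t + T\<^sub>1) ` N\<^sub>2)"
  have "L\<^sub>2-lipschitz_on {T\<^sub>1..T\<^sub>1 + T\<^sub>2} (\<lambda>t. \<gamma>\<^sub>2 (t - T\<^sub>1))"
  proof (rule lipschitz_onI)
    fix s t assume "s \<in> {T\<^sub>1..T\<^sub>1 + T\<^sub>2}" "t \<in> {T\<^sub>1..T\<^sub>1 + T\<^sub>2}"
    then show "dist (\<gamma>\<^sub>2 (s - T\<^sub>1)) (\<gamma>\<^sub>2 (t - T\<^sub>1)) \<le> L\<^sub>2 * dist s t"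
      using lipschitz_onD[OF 2(3), of "s - T\<^sub>1" "t - T\<^sub>1"] by (simp add: dist_real_def)
  qed (rule lipschitz_on_nonneg[OF 2(3)])
  then have "(max L\<^sub>1 L\<^sub>2)-lipschitz_on {0..T\<^sub>1 + T\<^sub>2} \<gamma>"
    unfolding \<gamma>_def by (intro lipschitz_on_concat_max 1) (simp_all add: 1 2)
  moreover have "finite N" using 1 2 by (simp add: N_def)
  moreover have "\<gamma> ` {0..T\<^sub>1 + T\<^sub>2} \<subseteq> SU2"
    using 1(4) 2(4) by (force simp: \<gamma>_def image_subset_iff)
  moreover have "\<gamma> 0 = p" "\<gamma> (T\<^sub>1 + T\<^sub>2) = r"
    using 1 2 by (auto simp: \<gamma>_def)
  moreover have "\<exists>w. cmod w \<le> 1 \<and> (\<gamma> has_vector_derivative \<gamma> t ** su 0 (w / 2)) (at t)"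
    if t: "t \<in> {0<..<T\<^sub>1 + T\<^sub>2} - N" for t
  proof (cases "t < T\<^sub>1")
    case True
    then obtain w where w: "cmod w \<le> 1" "(\<gamma>\<^sub>1 has_vector_derivative \<gamma>\<^sub>1 t ** su 0 (w / 2)) (at t)"
      using 1(7)[of t] t by (auto simp: N_def)
    have "(\<gamma> has_vector_derivative \<gamma>\<^sub>1 t ** su 0 (w / 2)) (at t)"
      by (rule has_vector_derivative_transform_within_open[OF w(2), of "{..<T\<^sub>1}"])
        (use True in \<open>auto simp: \<gamma>_def\<close>)
    with w(1) True show ?thesis by (auto simp: \<gamma>_def)
  next
    case False
    then have T: "T\<^sub>1 < t" using t by (auto simp: N_def)
    have "t - T\<^sub>1 \<in> {0<..<T\<^sub>2} - N\<^sub>2"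
      using t T by (force simp: N_def)
    from 2(7)[OF this] obtain w where w: "cmod w \<le> 1"
      "(\<gamma>\<^sub>2 has_vector_derivative \<gamma>\<^sub>2 (t - T\<^sub>1) ** su 0 (w / 2)) (at (t - T\<^sub>1))"
      by blast
    have "((\<lambda>t. t - T\<^sub>1) has_vector_derivative 1) (at t)"
      by (auto intro!: derivative_eq_intros)
    from vector_diff_chain_at[OF this w(2)]
    have d: "((\<lambda>t. \<gamma>\<^sub>2 (t - T\<^sub>1)) has_vector_derivative \<gamma>\<^sub>2 (t - T\<^sub>1) ** su 0 (w / 2)) (at t)"
      by (simp add: o_def)
    have "(\<gamma> has_vector_derivative \<gamma>\<^sub>2 (t - T\<^sub>1) ** su 0 (w / 2)) (at t)"
      by (rule has_vector_derivative_transform_within_open[OF d, of "{T\<^sub>1<..}"])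
        (use T in \<open>auto simp: \<gamma>_def\<close>)
    with w(1) T show ?thesis by (auto simp: \<gamma>_def)
  qed
  ultimately show ?thesis
    unfolding reach_def using 1(1) 2(1) by (intro conjI exI[of _ \<gamma>] exI[of _ "max L\<^sub>1 L\<^sub>2"] exI[of _ N]) auto
qed

lemma p_inner_nonneg: "0 \<le> p_inner X X"
  by (auto simp: p_inner_def intro: sum_nonneg)

lemma sr_length_nonneg: "0 \<le> sr_length T \<gamma>"
  unfolding sr_length_def Let_def sr_metric_def
  by (intro integral_nonneg_AE) (simp add: p_inner_nonneg)

lemma sr_dist_le:
  assumes "0 < T" "horizontal T \<gamma>" "\<gamma> 0 = p" "\<gamma> T = q"
  shows "sr_dist p q \<le> sr_length T \<gamma>"
  unfolding sr_dist_def
  by (intro cInf_lower bdd_belowI[where m = 0]) (use assms sr_length_nonneg in auto)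

text \<open>The existence claim serves the lower bounds: it shows that the infimum defining the
  distance is taken over a nonempty set.\<close>

lemma reach_imp_sr_dist_le:
  assumes "reach T p q" "0 < T"
  shows "sr_dist p q \<le> T" and "\<exists>\<gamma>. horizontal T \<gamma> \<and> \<gamma> 0 = p \<and> \<gamma> T = q"
proof -
  obtain \<gamma> L N where \<gamma>: "finite N" "L-lipschitz_on {0..T} \<gamma>" "\<gamma> ` {0..T} \<subseteq> SU2"
    "\<gamma> 0 = p" "\<gamma> T = q"
    "\<And>t. t \<in> {0<..<T} - N \<Longrightarrow> \<exists>w. cmod w \<le> 1 \<and> (\<gamma> has_vector_derivative \<gamma> t ** su 0 (w / 2)) (at t)"
    using assms(1) unfolding reach_def by blast
  have "AE t in lebesgue_on {0..T}. t \<in> {0..T} - insert 0 (insert T N)"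
    using \<gamma>(1) by (intro AE_lebesgue_on_Icc_minus_finite) simp
  then have AE_w: "AE t in lebesgue_on {0..T}. 0 < t \<and> t < T \<and>
      (\<exists>w. cmod w \<le> 1 \<and> (\<gamma> has_vector_derivative \<gamma> t ** su 0 (w / 2)) (at t))"
  proof eventually_elim
    case (elim t)
    then have "t \<in> {0<..<T} - N" by auto
    with \<gamma>(6)[OF this] show ?case by auto
  qed
  have hor: "horizontal T \<gamma>"
    unfolding horizontal_def
  proof (intro conjI)
    show "AE t in lebesgue_on {0..T}. \<exists>v\<in>distribution (\<gamma> t). (\<gamma> has_vector_derivative v) (at t within {0..T})"
      using AE_w
    proof eventually_elim
      case (elim t)
      then show ?case
        by (auto simp: distribution_def p_part_eq intro: has_vector_derivative_at_within)
    qed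
  qed (use \<gamma> in auto)
  then show "\<exists>\<gamma>. horizontal T \<gamma> \<and> \<gamma> 0 = p \<and> \<gamma> T = q"
    using \<gamma> by blast
  have speed: "AE t in lebesgue_on {0..T}. (let v = vector_derivative \<gamma> (at t within {0..T})
      in sqrt (sr_metric (\<gamma> t) v v)) \<le> 1"
    using AE_w
  proof eventually_elim
    case (elim t)
    then obtain w where w: "cmod w \<le> 1" "(\<gamma> has_vector_derivative \<gamma> t ** su 0 (w / 2)) (at t)"
      by blast
    have v: "vector_derivative \<gamma> (at t within {0..T}) = \<gamma> t ** su 0 (w / 2)"
      using vector_derivative_within_cbox[of 0 T t \<gamma>] elim w(2)
      by (simp add: has_vector_derivative_at_within)
    have g: "\<gamma> t \<in> SU2" using \<gamma>(3) elim by auto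
    define a b where "a = \<gamma> t $ 1 $ 1" and "b = \<gamma> t $ 1 $ 2"
    have gt: "\<gamma> t = su a b"
      using SU2_eq_su[OF g] by (simp add: a_def b_def)
    have "\<gamma> t ** su 0 (w / 2) = su (- (b * cnj w) / 2) (a * w / 2)"
      by (simp add: gt su_mult)
    then have "sr_metric (\<gamma> t) (\<gamma> t ** su 0 (w / 2)) (\<gamma> t ** su 0 (w / 2)) = (cmod w)\<^sup>2"
      using sr_metric_su[of a b w] g by (simp only: gt)
    then show ?case
      using w(1) by (simp add: v)
  qed
  have "sr_length T \<gamma> \<le> T"
  proof (cases "integrable (lebesgue_on {0..T}) (\<lambda>t. let v = vector_derivative \<gamma> (at t within {0..T})
      in sqrt (sr_metric (\<gamma> t) v v))")
    case True
    have "sr_length T \<gamma> \<le> (LINT t|lebesgue_on {0..T}. 1)"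
      unfolding sr_length_def
      by (rule integral_mono_AE[OF True _ speed]) (intro continuous_imp_integrable_real continuous_intros)
    then show ?thesis using assms(2) by (simp add: measure_restrict_space)
  next
    case False
    \<comment> \<open>The integral of a nonintegrable function is 0 by convention, so the bound
      holds here too.\<close>
    then show ?thesis
      unfolding sr_length_def using assms(2) by (simp add: not_integrable_integral_eq)
  qed
  with sr_dist_le[OF assms(2) hor \<gamma>(4,5)] show "sr_dist p q \<le> T"
    by linarith
qed

section \<open>Explicit horizontal arcs\<close>

lemma reach_su:
  assumes T: "0 \<le> T"
    and deriv: "\<And>t. (a has_vector_derivative - (b t * cnj (w t)) / 2) (at t)"
      "\<And>t. (b has_vector_derivative a t * w t / 2) (at t)"
    and w: "\<And>t. cmod (w t) \<le> 1"
    and unit: "\<And>t. (cmod (a t))\<^sup>2 + (cmod (b t))\<^sup>2 = 1"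
  shows "reach T (su (a 0) (b 0)) (su (a T) (b T))"
proof -
  let ?\<gamma> = "\<lambda>t. su (a t) (b t)"
  have d: "(?\<gamma> has_vector_derivative ?\<gamma> t ** su 0 (w t / 2)) (at t)" for t
    using has_vector_derivative_su[OF deriv] by (simp add: su_mult)
  have "norm (?\<gamma> t ** su 0 (w t / 2)) \<le> 1" for t
  proof -
    have "(norm (?\<gamma> t ** su 0 (w t / 2)))\<^sup>2 = ((cmod (a t))\<^sup>2 + (cmod (b t))\<^sup>2) * (cmod (w t))\<^sup>2 / 2"
      unfolding su_mult norm_su by (simp add: norm_mult norm_divide power_mult_distrib power_divide field_simps)
    also have "\<dots> \<le> 1\<^sup>2"
      unfolding unit using power_le_one[of "cmod (w t)" 2] w[of t] by simp
    finally show ?thesis by (rule power2_le_imp_le) simp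
  qed
  then have "1-lipschitz_on {0..T} ?\<gamma>"
    by (intro lipschitz_on_vector_derivative_bound[OF has_vector_derivative_at_within[OF d]]) auto
  moreover have "?\<gamma> ` {0..T} \<subseteq> SU2"
    by (auto simp: su_in_SU2_iff unit)
  moreover have "\<forall>t\<in>{0<..<T} - {}. \<exists>w. cmod w \<le> 1 \<and> (?\<gamma> has_vector_derivative ?\<gamma> t ** su 0 (w / 2)) (at t)"
    using w d by blast
  ultimately show ?thesis
    unfolding reach_def using T
    by (intro conjI exI[of _ ?\<gamma>] exI[of _ "1::real"] exI[of _ "{}"]) auto
qed

lemma has_vector_derivative_cis_linear:
  "((\<lambda>t. cis (k * t)) has_vector_derivative \<i> * of_real k * cis (k * t)) (at t within S)"
proof -
  have "((\<lambda>t. k * t) has_derivative (\<lambda>h. k * h)) (at t within S)"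
    by (auto intro!: derivative_eq_intros)
  from has_derivative_cis[OF this] show ?thesis
    by (simp add: has_vector_derivative_def scaleR_conv_of_real mult_ac)
qed

text \<open>The control of a geodesic is cis(\<theta> + c t), a unit vector rotating at the constant
  rate c. Arbitrary starting times are included because the competitor beyond the cusp ends with a
  later piece of the same geodesic.\<close>

lemma reach_Exp:
  assumes "t\<^sub>1 \<le> t\<^sub>2"
  shows "reach (t\<^sub>2 - t\<^sub>1) (Exp \<theta> c t\<^sub>1) (Exp \<theta> c t\<^sub>2)"
proof -
  define \<omega> where "\<omega> = sqrt (1 + c\<^sup>2)"
  have om: "\<omega> > 0" "\<omega> * \<omega> = 1 + c * c"
    by (simp_all add: \<omega>_def add_pos_nonneg flip: power2_eq_square)
  define C where "C t = Complex (cos (\<omega> * t / 2)) (c / \<omega> * sin (\<omega> * t / 2))" for t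
  define C' where "C' t = Complex (- \<omega> / 2 * sin (\<omega> * t / 2)) (c / 2 * cos (\<omega> * t / 2))" for t
  define e where "e t = cis ((- c / 2) * t)" for t
  define E where "E t = cis ((c / 2) * t)" for t
  define r where "r t = sin (\<omega> * t / 2) / \<omega>" for t
  define a where "a t = C t * e t" for t
  define b where "b t = cis \<theta> * (of_real (r t) * E t)" for t
  define w where "w t = cis (\<theta> + c * t)" for t
  have Exp: "Exp \<theta> c t = su (a t) (b t)" for t
    unfolding Exp_eq_su by (simp add: a_def b_def C_def e_def E_def r_def \<omega>_def mult.assoc)
  have C: "(C has_vector_derivative C' t) (at t)" for t
    using om(1) unfolding C_def C'_def
    by (auto simp: has_vector_derivative_complex_iff intro!: derivative_eq_intros)
  have e: "(e has_vector_derivative \<i> * of_real (- c / 2) * e t) (at t)"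
    and E: "(E has_vector_derivative \<i> * of_real (c / 2) * E t) (at t)" for t
    unfolding e_def E_def by (rule has_vector_derivative_cis_linear)+
  have r: "((\<lambda>t. of_real (r t)) has_vector_derivative of_real (cos (\<omega> * t / 2) / 2)) (at t)" for t
    using om(1) unfolding r_def
    by (intro has_vector_derivative_of_real) (auto intro!: derivative_eq_intros
        simp flip: has_real_derivative_iff_has_vector_derivative)
  have bw: "b t * cnj (w t) = of_real (r t) * e t" for t
    by (simp add: b_def w_def E_def e_def cis_cnj cis_mult mult_ac)
  have aw: "a t * w t = cis \<theta> * (C t * E t)" for t
    by (simp add: a_def w_def E_def e_def cis_mult mult_ac) (simp add: mult.left_commute cis_mult add.commute)
  have CC: "C' t + C t * (\<i> * of_real (- c / 2)) = - of_real (r t) / 2" for t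
  proof -
    have "c * c / \<omega> = \<omega> - 1 / \<omega>"
      using om by (simp add: field_simps)
    then have *: "c / \<omega> * S * (c / 2) - \<omega> / 2 * S = - (S / \<omega>) / 2" for S
      by algebra
    show ?thesis
      using *[of "sin (\<omega> * t / 2)"] by (simp add: C_def C'_def r_def complex_eq_iff)
  qed
  have a': "(a has_vector_derivative - (b t * cnj (w t)) / 2) (at t)" for t
  proof -
    have "C t * (\<i> * of_real (- c / 2) * e t) + C' t * e t = (C' t + C t * (\<i> * of_real (- c / 2))) * e t"
      by (simp add: algebra_simps)
    also have "\<dots> = - (b t * cnj (w t)) / 2"
      unfolding CC bw by simp
    finally show ?thesis
      using has_vector_derivative_mult[OF C e, of t] unfolding a_def by simp
  qed
  have rC: "of_real (r t) * (\<i> * of_real (c / 2)) + of_real (cos (\<omega> * t / 2) / 2) = C t / 2" for t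
    by (simp add: C_def r_def complex_eq_iff)
  have b': "(b has_vector_derivative a t * w t / 2) (at t)" for t
  proof -
    have "of_real (r t) * (\<i> * of_real (c / 2) * E t) + of_real (cos (\<omega> * t / 2) / 2) * E t
        = (of_real (r t) * (\<i> * of_real (c / 2)) + of_real (cos (\<omega> * t / 2) / 2)) * E t"
      by (simp add: algebra_simps)
    also have "\<dots> = C t / 2 * E t"
      unfolding rC ..
    finally have eq: "of_real (r t) * (\<i> * of_real (c / 2) * E t) + of_real (cos (\<omega> * t / 2) / 2) * E t
        = C t / 2 * E t" .
    show ?thesis
      using has_vector_derivative_mult_right[OF has_vector_derivative_mult[OF r E, of t], of "cis \<theta>"]
      unfolding b_def[abs_def] aw eq by simp
  qed
  have unit: "(cmod (a t))\<^sup>2 + (cmod (b t))\<^sup>2 = 1" for t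
  proof -
    have "(cmod (a t))\<^sup>2 + (cmod (b t))\<^sup>2
        = (cos (\<omega> * t / 2))\<^sup>2 + (c\<^sup>2 / \<omega>\<^sup>2 + 1 / \<omega>\<^sup>2) * (sin (\<omega> * t / 2))\<^sup>2"
      by (simp add: a_def b_def e_def E_def C_def r_def norm_mult cmod_power2 power_mult_distrib
          power_divide distrib_right norm_divide)
    also have "c\<^sup>2 / \<omega>\<^sup>2 + 1 / \<omega>\<^sup>2 = 1"
    proof -
      have om2: "c\<^sup>2 + 1 = \<omega>\<^sup>2"
        using om(2) by (simp add: power2_eq_square)
      show ?thesis
        unfolding add_divide_distrib[symmetric] om2 using om(1) by simp
    qed
    finally show ?thesis by simp
  qed
  have shift: "((\<lambda>s. f (t\<^sub>1 + s)) has_vector_derivative f') (at s)"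
    if "(f has_vector_derivative f') (at (t\<^sub>1 + s))" for f :: "real \<Rightarrow> complex" and f' s
  proof -
    have "((\<lambda>s. t\<^sub>1 + s) has_vector_derivative 1) (at s)"
      by (auto intro!: derivative_eq_intros)
    from vector_diff_chain_at[OF this that] show ?thesis
      by (simp add: o_def)
  qed
  have "reach (t\<^sub>2 - t\<^sub>1) (su (a (t\<^sub>1 + 0)) (b (t\<^sub>1 + 0))) (su (a (t\<^sub>1 + (t\<^sub>2 - t\<^sub>1))) (b (t\<^sub>1 + (t\<^sub>2 - t\<^sub>1))))"
  proof (rule reach_su[where w = "\<lambda>s. w (t\<^sub>1 + s)"])
    show "((\<lambda>s. a (t\<^sub>1 + s)) has_vector_derivative - (b (t\<^sub>1 + s) * cnj (w (t\<^sub>1 + s))) / 2) (at s)" for s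
      by (rule shift[OF a'])
    show "((\<lambda>s. b (t\<^sub>1 + s)) has_vector_derivative a (t\<^sub>1 + s) * w (t\<^sub>1 + s) / 2) (at s)" for s
      by (rule shift[OF b'])
  qed (use assms unit in \<open>auto simp: w_def\<close>)
  then show ?thesis
    by (simp add: Exp)
qed

text \<open>Asking that the first entry merely rotate, a' = \<i> k a, determines the control w = 2
  \<i> k cnj a / cnj b; then b' = \<i> k |a|^2 / |b|^2 b, so the second entry merely rotates as
  well. The last hypothesis says |w| \<le> 1.\<close>

lemma reach_phase_arc:
  assumes T: "0 \<le> T" and unit: "(cmod a)\<^sup>2 + (cmod b)\<^sup>2 = 1" and b: "b \<noteq> 0"
    and k: "2 * \<bar>k\<bar> * cmod a \<le> cmod b"
  shows "reach T (su a b) (su (a * cis (k * T)) (b * cis (k * (cmod a)\<^sup>2 / (cmod b)\<^sup>2 * T)))"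
proof -
  define k' where "k' = k * (cmod a)\<^sup>2 / (cmod b)\<^sup>2"
  define A where "A t = a * cis (k * t)" for t
  define B where "B t = b * cis (k' * t)" for t
  define w where "w t = 2 * \<i> * of_real k * cnj (A t) / cnj (B t)" for t
  have B0: "B t \<noteq> 0" for t using b by (simp add: B_def)
  have A2: "A t * cnj (A t) = of_real ((cmod a)\<^sup>2)" for t
    using complex_norm_square[of "A t"] by (simp add: A_def norm_mult)
  have B2: "B t * cnj (B t) = of_real ((cmod b)\<^sup>2)" for t
    using complex_norm_square[of "B t"] by (simp add: B_def norm_mult)
  have "reach T (su (A 0) (B 0)) (su (A T) (B T))"
  proof (rule reach_su[where w = w, OF T])
    fix t
    have "- (B t * cnj (w t)) / 2 = a * (\<i> * of_real k * cis (k * t))"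
      using B0[of t] by (simp add: w_def A_def)
    then show "(A has_vector_derivative - (B t * cnj (w t)) / 2) (at t)"
      unfolding A_def using has_vector_derivative_mult_right[OF has_vector_derivative_cis_linear, of a k t UNIV]
      by simp
    have "A t * w t / 2 = \<i> * of_real k * (A t * cnj (A t)) / cnj (B t)"
      by (simp add: w_def)
    also have "\<dots> = \<i> * of_real k' * B t"
    proof -
      have "of_real ((cmod b)\<^sup>2) \<noteq> (0::complex)" using b by simp
      then show ?thesis
        unfolding A2 k'_def of_real_divide of_real_mult B2[of t, symmetric] using B0[of t] by simp
    qed
    also have "\<dots> = b * (\<i> * of_real k' * cis (k' * t))"
      by (simp add: B_def)
    finally show "(B has_vector_derivative A t * w t / 2) (at t)"
      unfolding B_def using has_vector_derivative_mult_right[OF has_vector_derivative_cis_linear, of b k' t UNIV]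
      by simp
    show "cmod (w t) \<le> 1"
      using k b by (simp add: w_def A_def B_def norm_mult norm_divide divide_le_eq)
    show "(cmod (A t))\<^sup>2 + (cmod (B t))\<^sup>2 = 1"
      using unit by (simp add: A_def B_def norm_mult)
  qed
  then show ?thesis
    by (simp add: A_def B_def k'_def)
qed

lemma reach_in_SU2: "reach T p q \<Longrightarrow> q \<in> SU2"
  by (fastforce simp: reach_def)

lemma Exp_zero: "Exp \<theta> c 0 = mat 1"
  unfolding Exp_eq_su by (simp add: complex_eq_iff su_eq_iff flip: su_one)

lemma reach_Exp_from_identity: "0 \<le> t \<Longrightarrow> reach t (mat 1) (Exp \<theta> c t)"
  using reach_Exp[of 0 t \<theta> c] by (simp add: Exp_zero)

text \<open>The constant curve has control 0 and may be given any duration.\<close>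

lemma sr_dist_identity: "0 < t \<Longrightarrow> sr_dist (mat 1) (mat 1) \<le> t"
  using reach_su[of t "\<lambda>_. 1" "\<lambda>_. 0" "\<lambda>_. 0"] reach_imp_sr_dist_le(1)[of t "mat 1" "mat 1"]
  by (simp add: su_one)

section \<open>Loss of optimality\<close>

text \<open>arctan(s tan y) is the argument of cos y + \<i> s sin y, and s y its linear
  approximation. The derivative of the difference carries the factor (sin u)^2, and its denominator
  is at least 1/2 for u \<le> 1/8; the mean value theorem adds one more power of y.\<close>

lemma arctan_scaled_tan_bound:
  assumes s: "\<bar>s\<bar> \<le> 1" and y: "0 < y" "y \<le> 1/8"
  shows "\<bar>arctan (s * tan y) - s * y\<bar> \<le> 2 * y ^ 3"
proof -
  let ?f = "\<lambda>u. arctan (s * tan u) - s * u"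
  let ?f' = "\<lambda>u. s * (1 - s\<^sup>2) * (sin u)\<^sup>2 / ((cos u)\<^sup>2 + s\<^sup>2 * (sin u)\<^sup>2)"
  have sin2: "(sin u)\<^sup>2 \<le> u\<^sup>2" for u :: real
    using abs_sin_x_le_abs_x[of u] by (simp add: abs_le_square_iff)
  have cos2: "1/2 \<le> (cos u)\<^sup>2" if "0 \<le> u" "u \<le> y" for u
  proof -
    have "u\<^sup>2 \<le> (1/8)\<^sup>2"
      using that y by (intro power_mono) auto
    then show ?thesis
      using sin2[of u] sin_cos_squared_add[of u] by (simp add: power2_eq_square)
  qed
  have s2: "0 \<le> s\<^sup>2" "s\<^sup>2 \<le> 1"
    using s by (auto simp: abs_square_le_1)
  have D: "(?f has_real_derivative ?f' u) (at u)" if "0 \<le> u" "u \<le> y" for u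
  proof -
    have c0: "cos u \<noteq> 0" using cos2[OF that] by auto
    have den: "(cos u)\<^sup>2 + s\<^sup>2 * (sin u)\<^sup>2 > 0"
      using c0 s2(1) by (intro add_pos_nonneg) auto
    have "(?f has_real_derivative s * (1 / (cos u)\<^sup>2) / (1 + (s * tan u)\<^sup>2) - s) (at u)"
      using DERIV_diff[OF DERIV_chain2[OF DERIV_arctan DERIV_cmult[OF DERIV_tan[OF c0], of s]] DERIV_cmult_Id[of s]]
      by (simp add: divide_inverse mult_ac)
    moreover have "s * (1 / (cos u)\<^sup>2) / (1 + (s * tan u)\<^sup>2) = s / ((cos u)\<^sup>2 + s\<^sup>2 * (sin u)\<^sup>2)"
      using c0 den by (simp add: tan_def power_mult_distrib power_divide divide_simps)
    moreover have "s / ((cos u)\<^sup>2 + s\<^sup>2 * (sin u)\<^sup>2) - s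
        = s * (1 - ((cos u)\<^sup>2 + s\<^sup>2 * (sin u)\<^sup>2)) / ((cos u)\<^sup>2 + s\<^sup>2 * (sin u)\<^sup>2)"
      using den by (simp add: divide_simps algebra_simps)
    moreover have "1 - ((cos u)\<^sup>2 + s\<^sup>2 * (sin u)\<^sup>2) = (1 - s\<^sup>2) * (sin u)\<^sup>2"
      using sin_cos_squared_add[of u] by (simp add: algebra_simps)
    ultimately show ?thesis by (simp only: mult.assoc)
  qed
  obtain \<xi> where \<xi>: "0 < \<xi>" "\<xi> < y" "?f y - ?f 0 = (y - 0) * ?f' \<xi>"
    using MVT2[OF y(1), of ?f ?f'] D by blast
  have den: "1/2 \<le> (cos \<xi>)\<^sup>2 + s\<^sup>2 * (sin \<xi>)\<^sup>2"
    using cos2[of \<xi>] \<xi> s2 by (simp add: add_increasing2)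
  have num: "\<bar>s * (1 - s\<^sup>2) * (sin \<xi>)\<^sup>2\<bar> \<le> y\<^sup>2"
  proof -
    have "\<bar>s\<bar> * (1 - s\<^sup>2) \<le> 1 * 1"
      using s s2 by (intro mult_mono) auto
    moreover have "(sin \<xi>)\<^sup>2 \<le> y\<^sup>2"
      using sin2[of \<xi>] \<xi> power_mono[of \<xi> y 2] by linarith
    ultimately have "\<bar>s\<bar> * (1 - s\<^sup>2) * (sin \<xi>)\<^sup>2 \<le> 1 * y\<^sup>2"
      by (intro mult_mono) auto
    then show ?thesis
      using s2 by (simp add: abs_mult)
  qed
  have "\<bar>?f' \<xi>\<bar> \<le> y\<^sup>2 / (1/2)"
    unfolding abs_divide using num den by (intro frac_le) auto
  then have "y * \<bar>?f' \<xi>\<bar> \<le> y * (2 * y\<^sup>2)"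
    using y by (intro mult_left_mono) auto
  then show ?thesis
    using \<xi>(3) y by (simp add: abs_mult power3_eq_cube power2_eq_square)
qed

lemma half_le_sin:
  fixes y :: real
  assumes "0 < y" "y \<le> 1"
  shows "y / 2 \<le> sin y"
proof -
  obtain \<xi> where \<xi>: "0 < \<xi>" "\<xi> < y" "sin y - sin 0 = (y - 0) * cos \<xi>"
    using MVT2[OF assms(1), of sin cos] by auto
  have "cos (pi / 3) < cos \<xi>"
    using \<xi> assms pi_gt3 by (intro cos_monotone_0_pi) auto
  then have "y * (1 / 2) \<le> y * cos \<xi>"
    using assms by (intro mult_left_mono) (auto simp: cos_60)
  with \<xi>(3) show ?thesis by simp
qed

text \<open>Near the cusp the first entry of a geodesic is this number up to sign, conjugation and
  the factor cis(- c t / 2).\<close>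

lemma Complex_polar_arctan:
  assumes "cos y > 0"
  shows "Complex (cos y) (s * sin y)
    = of_real (cos y / cos (arctan (s * tan y))) * cis (arctan (s * tan y))"
proof -
  let ?\<beta> = "arctan (s * tan y)"
  have c: "cos ?\<beta> > 0"
    using arctan_bounded[of "s * tan y"] by (intro cos_gt_zero_pi) auto
  have "sin ?\<beta> / cos ?\<beta> = s * (sin y / cos y)"
    using tan_arctan[of "s * tan y"] by (simp add: tan_def)
  then show ?thesis
    using c assms by (simp add: complex_eq_iff field_simps)
qed

text \<open>At \<open>\<omega> t = 2 * pi\<close> all the geodesics with the same \<open>c\<close> meet on \<open>exp k\<close>, so the initial
  arc may be replaced by the one of another angle, and the resulting cusp is cut off by an arc on
  which both entries have constant modulus. With the cut at \<open>x = pi - y\<close> and \<open>x = pi + y\<close> the phases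
  to be matched differ by \<open>O(y\<^sup>3)\<close>, while the time saved is of order \<open>y\<close>.\<close>

lemma sr_dist_Exp_less_beyond_cusp:
  fixes c t \<theta> :: real
  defines "\<omega> \<equiv> sqrt (1 + c\<^sup>2)"
  assumes t: "2 * pi < \<omega> * t"
  shows "sr_dist (mat 1) (Exp \<theta> c t) < t"
proof -
  have om1: "1 \<le> \<omega>" and om2: "\<omega>\<^sup>2 = 1 + c\<^sup>2"
    by (simp_all add: \<omega>_def)
  have om0: "0 < \<omega>" using om1 by simp
  define s where "s = c / \<omega>"
  have s1: "\<bar>s\<bar> \<le> 1"
  proof -
    have "\<bar>c\<bar>\<^sup>2 \<le> \<omega>\<^sup>2" by (simp add: om2)
    then have "\<bar>c\<bar> \<le> \<omega>" by (rule power2_le_imp_le) (use om0 in simp)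
    then show ?thesis using om0 by (simp add: s_def)
  qed
  \<comment> \<open>The first bound gives y \<omega>^2 \<le> 1/8, which keeps the cutting arc within
    unit speed; the second keeps its end from lying after time t.\<close>
  define y where "y = min (1 / (8 * \<omega>\<^sup>2)) (\<omega> * t / 2 - pi)"
  have y0: "0 < y" using om0 t by (simp add: y_def)
  have y_om: "y * \<omega>\<^sup>2 \<le> 1/8"
  proof -
    have "y * \<omega>\<^sup>2 \<le> 1 / (8 * \<omega>\<^sup>2) * \<omega>\<^sup>2"
      by (intro mult_right_mono) (auto simp: y_def)
    then show ?thesis using om0 by simp
  qed
  have y8: "y \<le> 1/8"
    using y_om mult_left_mono[of 1 "\<omega>\<^sup>2" y] y0 one_le_power[OF om1, of 2] by linarith
  have sin_y: "0 < sin y" "y / 2 \<le> sin y"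
    using half_le_sin[of y] y0 y8 by auto
  have cos_y: "0 < cos y"
    using y0 y8 pi_gt3 by (intro cos_gt_zero_pi) auto
  define t\<^sub>1 t\<^sub>2 T where "t\<^sub>1 = 2 * (pi - y) / \<omega>" and "t\<^sub>2 = 2 * (pi + y) / \<omega>" and "T = 2 * y / \<omega>"
  have x12: "\<omega> * t\<^sub>1 / 2 = pi - y" "\<omega> * t\<^sub>2 / 2 = pi + y"
    using om0 by (auto simp: t\<^sub>1_def t\<^sub>2_def)
  have t2: "t\<^sub>2 \<le> t"
  proof -
    have "2 * (pi + y) \<le> t * \<omega>" by (simp add: y_def algebra_simps min_def)
    then show ?thesis using om0 by (simp add: t\<^sub>2_def divide_le_eq)
  qed
  have t1: "0 < t\<^sub>1" using om0 y8 pi_gt3 by (simp add: t\<^sub>1_def)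
  have T0: "0 < T" using om0 y0 by (simp add: T_def)
  have time: "t\<^sub>1 + T + (t - t\<^sub>2) = t - T"
    using om0 by (simp add: t\<^sub>1_def t\<^sub>2_def T_def field_simps)
  define \<beta> where "\<beta> = arctan (s * tan y)"
  define \<rho> where "\<rho> = cos y / cos \<beta>"
  define k where "k = 2 * (\<beta> - s * y) / T"
  have \<beta>: "\<bar>\<beta> - s * y\<bar> \<le> 2 * y ^ 3"
    unfolding \<beta>_def by (rule arctan_scaled_tan_bound[OF s1 y0 y8])
  have polar: "Complex (cos y) (s * sin y) = of_real \<rho> * cis \<beta>"
    unfolding \<rho>_def \<beta>_def by (rule Complex_polar_arctan[OF cos_y])
  have polar1: "Complex (- cos y) (s * sin y) = - of_real \<rho> * cis (- \<beta>)"
    using arg_cong[OF polar, of "\<lambda>z. - cnj z"] by (simp add: cis_cnj complex_eq_iff)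
  have polar2: "Complex (- cos y) (- (s * sin y)) = - of_real \<rho> * cis \<beta>"
    using arg_cong[OF polar, of uminus] by (simp add: complex_eq_iff)
  define A\<^sub>1 where "A\<^sub>1 = - of_real \<rho> * cis (- \<beta>) * cis (- (c * t\<^sub>1 / 2))"
  \<comment> \<open>The rate of the second entry, written with the modulus sin y / \<omega> instead
    of \<open>B\<^sub>1\<close>, because the angle in \<open>B\<^sub>1\<close> is chosen from
    it.\<close>
  define k' where "k' = k * (cmod A\<^sub>1)\<^sup>2 / (sin y / \<omega>)\<^sup>2"
  \<comment> \<open>The initial angle is free and is used to match the second entry: pi accounts for
    the sign of sin(pi + y), the last term cancels the rotation along the arc.\<close>
  define \<theta>\<^sub>1 where "\<theta>\<^sub>1 = \<theta> + pi + c * (t\<^sub>2 - t\<^sub>1) / 2 - k' * T"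
  define B\<^sub>1 where "B\<^sub>1 = cis \<theta>\<^sub>1 * of_real (sin y / \<omega>) * cis (c * t\<^sub>1 / 2)"
  have E1: "Exp \<theta>\<^sub>1 c t\<^sub>1 = su A\<^sub>1 B\<^sub>1"
    unfolding Exp_eq_su \<omega>_def[symmetric] s_def[symmetric] x12 A\<^sub>1_def B\<^sub>1_def polar1[symmetric]
    by (simp add: sin_diff cos_diff)
  have E2: "Exp \<theta> c t\<^sub>2 = su (- of_real \<rho> * cis \<beta> * cis (- (c * t\<^sub>2 / 2)))
      (cis \<theta> * of_real (- sin y / \<omega>) * cis (c * t\<^sub>2 / 2))"
    unfolding Exp_eq_su \<omega>_def[symmetric] s_def[symmetric] x12 polar2[symmetric]
    by (simp add: sin_add cos_add)
  have normB: "cmod B\<^sub>1 = sin y / \<omega>"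
    using sin_y om0 by (simp add: B\<^sub>1_def norm_mult norm_divide)
  have "reach t\<^sub>1 (mat 1) (su A\<^sub>1 B\<^sub>1)"
    using reach_Exp_from_identity[of t\<^sub>1 \<theta>\<^sub>1 c] t1 by (simp add: E1)
  moreover have "reach T (su A\<^sub>1 B\<^sub>1) (Exp \<theta> c t\<^sub>2)"
  proof -
    have unit: "(cmod A\<^sub>1)\<^sup>2 + (cmod B\<^sub>1)\<^sup>2 = 1"
      using reach_in_SU2[OF calculation] by (simp add: su_in_SU2_iff)
    have A_le: "cmod A\<^sub>1 \<le> 1"
    proof (rule power2_le_imp_le)
      show "(cmod A\<^sub>1)\<^sup>2 \<le> 1\<^sup>2"
        unfolding one_power2 using unit zero_le_power2[of "cmod B\<^sub>1"] by linarith
    qed simp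
    have "\<bar>k\<bar> * T \<le> 4 * y ^ 3"
      using \<beta> T0 by (simp add: k_def abs_mult)
    then have "\<bar>k\<bar> * (2 * y) \<le> 4 * y ^ 3 * \<omega>"
      using om0 by (simp add: T_def divide_le_eq)
    then have "y * \<bar>k\<bar> \<le> y * (2 * y\<^sup>2 * \<omega>)"
      by (simp add: power3_eq_cube power2_eq_square algebra_simps)
    then have "\<bar>k\<bar> \<le> 2 * y\<^sup>2 * \<omega>"
      using y0 by (simp only: mult_le_cancel_left_pos)
    \<comment> \<open>The unit speed condition of the arc: 4 y^2 \<omega> = 4 y (y \<omega>^2) /
      \<omega> is at most y / (2 \<omega>), which half the linear bound for the sine covers.\<close>
    then have "2 * \<bar>k\<bar> * cmod A\<^sub>1 \<le> 2 * (2 * y\<^sup>2 * \<omega>) * 1"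
      using A_le by (intro mult_mono) auto
    also have "\<dots> = 4 * (y * (y * \<omega>\<^sup>2)) / \<omega>"
      using om0 by (simp add: power2_eq_square)
    also have "\<dots> \<le> 4 * (y * (1 / 8)) / \<omega>"
      using y_om y0 om0 by (intro divide_right_mono mult_left_mono) auto
    also have "\<dots> \<le> sin y / \<omega>"
      using sin_y om0 by (intro divide_right_mono) auto
    finally have k_le: "2 * \<bar>k\<bar> * cmod A\<^sub>1 \<le> cmod B\<^sub>1"
      by (simp add: normB)
    have "B\<^sub>1 \<noteq> 0"
      using normB sin_y om0 by auto
    note arc = reach_phase_arc[OF less_imp_le[OF T0] unit this k_le]
    have ct: "c * t\<^sub>2 / 2 = c * t\<^sub>1 / 2 + 2 * (s * y)"
      using om0 by (simp add: t\<^sub>1_def t\<^sub>2_def s_def field_simps)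
    have kT: "k * T = 2 * (\<beta> - s * y)"
      using T0 by (simp add: k_def)
    have "A\<^sub>1 * cis (k * T) = - of_real \<rho> * cis (- \<beta> + - (c * t\<^sub>1 / 2) + k * T)"
      by (simp add: A\<^sub>1_def mult.assoc cis_mult)
    also have "- \<beta> + - (c * t\<^sub>1 / 2) + k * T = \<beta> + - (c * t\<^sub>2 / 2)"
      unfolding ct kT by simp
    finally have A: "A\<^sub>1 * cis (k * T) = - of_real \<rho> * cis \<beta> * cis (- (c * t\<^sub>2 / 2))"
      by (simp add: mult.assoc cis_mult)
    have k': "k * (cmod A\<^sub>1)\<^sup>2 / (cmod B\<^sub>1)\<^sup>2 * T = k' * T"
      by (simp add: k'_def normB)
    have "B\<^sub>1 * cis (k' * T) = of_real (sin y / \<omega>) * cis (\<theta>\<^sub>1 + c * t\<^sub>1 / 2 + k' * T)"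
      by (simp add: B\<^sub>1_def cis_mult mult_ac) (simp add: mult.left_commute cis_mult add_ac)
    also have "\<theta>\<^sub>1 + c * t\<^sub>1 / 2 + k' * T = \<theta> + c * t\<^sub>2 / 2 + pi"
      by (simp add: \<theta>\<^sub>1_def algebra_simps diff_divide_distrib)
    also have "cis \<dots> = - (cis \<theta> * cis (c * t\<^sub>2 / 2))"
      by (simp add: cis_mult minus_cis)
    finally have B: "B\<^sub>1 * cis (k' * T) = cis \<theta> * of_real (- sin y / \<omega>) * cis (c * t\<^sub>2 / 2)"
      by simp
    show ?thesis
      using arc unfolding k' A B E2 .
  qed
  ultimately have "reach (t\<^sub>1 + T) (mat 1) (Exp \<theta> c t\<^sub>2)"
    by (rule reach_trans)
  from reach_trans[OF this reach_Exp[OF t2]] have "reach (t - T) (mat 1) (Exp \<theta> c t)"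
    unfolding time .
  moreover have "0 < t - T"
    using time t1 T0 t2 by linarith
  ultimately have "sr_dist (mat 1) (Exp \<theta> c t) \<le> t - T"
    by (rule reach_imp_sr_dist_le(1))
  then show ?thesis using T0 by linarith
qed

lemma optimal_imp_before_cusp: "optimal \<theta> c t \<Longrightarrow> sqrt (1 + c\<^sup>2) * t \<le> 2 * pi"
  using sr_dist_Exp_less_beyond_cusp[of c t \<theta>] unfolding optimal_def by linarith

section \<open>The cut locus\<close>

lemma x_cos_less_sin:
  fixes x :: real
  assumes "0 < x" "x \<le> pi"
  shows "x * cos x < sin x"
proof -
  let ?f = "\<lambda>u::real. sin u - u * cos u"
  have "?f 0 < ?f x"
  proof (rule DERIV_pos_imp_increasing_open[OF assms(1)])
    fix u assume u: "0 < u" "u < x"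
    have "(?f has_real_derivative u * sin u) (at u)"
      by (auto intro!: derivative_eq_intros)
    moreover have "0 < u * sin u"
      using u assms by (simp add: sin_gt_zero)
    ultimately show "\<exists>y. (?f has_real_derivative y) (at u) \<and> 0 < y" by blast
  qed (intro continuous_intros)
  then show ?thesis by simp
qed

text \<open>Both sides are moduli of the second entry at time t. The sign of the derivative in the
  frequency is that of x cos x - sin x with x = w t / 2, so up to the cusp the modulus determines
  the frequency.\<close>

lemma sin_over_frequency_strict_antimono:
  assumes "0 < \<omega>\<^sub>1" "\<omega>\<^sub>1 < \<omega>\<^sub>2" "0 < t" "\<omega>\<^sub>2 * t \<le> 2 * pi"
  shows "sin (\<omega>\<^sub>2 * t / 2) / \<omega>\<^sub>2 < sin (\<omega>\<^sub>1 * t / 2) / \<omega>\<^sub>1"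
proof -
  let ?f = "\<lambda>w::real. sin (w * t / 2) / w"
  have "?f \<omega>\<^sub>2 < ?f \<omega>\<^sub>1"
  proof (rule DERIV_neg_imp_decreasing_open[OF assms(2)])
    fix w assume w: "\<omega>\<^sub>1 < w" "w < \<omega>\<^sub>2"
    then have w0: "0 < w" using assms by linarith
    have "w * t < \<omega>\<^sub>2 * t" using w assms by simp
    then have "w * t \<le> 2 * pi" using assms by linarith
    then have "w * t / 2 * cos (w * t / 2) < sin (w * t / 2)"
      using w0 assms by (intro x_cos_less_sin) auto
    then have "(w * t / 2 * cos (w * t / 2) - sin (w * t / 2)) / w\<^sup>2 < 0"
      using w0 by (simp add: divide_less_0_iff)
    moreover have "(?f has_real_derivative (w * t / 2 * cos (w * t / 2) - sin (w * t / 2)) / w\<^sup>2) (at w)"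
      using w0 by (auto intro!: derivative_eq_intros simp: power2_eq_square)
    ultimately show "\<exists>y. (?f has_real_derivative y) (at w) \<and> y < 0" by blast
  next
    show "continuous_on {\<omega>\<^sub>1..\<omega>\<^sub>2} ?f"
      using assms by (intro continuous_intros) auto
  qed
  then show ?thesis .
qed

text \<open>The expression is the imaginary part of (cos x + \<i> s sin x) cis(- s x), the first
  entry of a geodesic with s = c / \<omega>. Its derivative in x is (1 - s^2) sin x sin(s x). Since
  it does not vanish, c and -c lead to different end points.\<close>

lemma phase_sin_pos:
  fixes s x :: real
  assumes "0 < s" "s < 1" "0 < x" "x \<le> pi"
  shows "0 < s * sin x * cos (s * x) - cos x * sin (s * x)"
proof -
  let ?f = "\<lambda>u::real. s * sin u * cos (s * u) - cos u * sin (s * u)"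
  have "?f 0 < ?f x"
  proof (rule DERIV_pos_imp_increasing_open[OF assms(3)])
    fix u assume u: "0 < u" "u < x"
    have "(?f has_real_derivative (1 - s\<^sup>2) * (sin u * sin (s * u))) (at u)"
      by (auto intro!: derivative_eq_intros simp: algebra_simps power2_eq_square)
    moreover have "s * u < 1 * pi"
      using u assms by (intro mult_strict_mono') auto
    then have "0 < (1 - s\<^sup>2) * (sin u * sin (s * u))"
      using u assms by (intro mult_pos_pos sin_gt_zero) (auto simp: power_less_one_iff)
    ultimately show "\<exists>y. (?f has_real_derivative y) (at u) \<and> 0 < y" by blast
  qed (intro continuous_intros)
  then show ?thesis by simp
qed

lemma cis_eq_iff_rcong: "cis x = cis y \<longleftrightarrow> [x = y] (rmod (2 * pi))"
proof -
  have "cis x = cis y \<longleftrightarrow> sin y = sin x \<and> cos y = cos x"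
    by (auto simp: complex_eq_iff)
  also have "\<dots> \<longleftrightarrow> [x = y] (rmod (2 * pi))"
    unfolding sin_cos_eq_iff rcong_altdef by (simp add: mult_ac)
  finally show ?thesis .
qed

lemma unit_complex_eq_cis:
  assumes "cmod z = 1"
  obtains \<phi> where "0 \<le> \<phi>" "\<phi> < 2 * pi" "z = cis \<phi>"
proof (rule that[of "Arg2pi z"])
  show "z = cis (Arg2pi z)"
    using Arg2pi_eq[of z] assms by (simp add: cis_conv_exp)
qed (use Arg2pi[of z] in auto)

section \<open>The subgroup exp(k) and the two inclusions\<close>

lemma exp_k_eq: "matrix_exp ` k_part = {su (cis \<phi>) 0 | \<phi>. True}"
proof -
  have k_part: "k_part = range (\<lambda>r. r *\<^sub>R k0)"
    unfolding k_part_def by (simp add: span_singleton)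
  have "matrix_exp ` k_part = range (\<lambda>r. su (cis (r / 2)) 0)"
    unfolding k_part image_image matrix_exp_k ..
  also have "\<dots> = {su (cis \<phi>) 0 | \<phi>. True}"
  proof -
    have "su (cis \<phi>) 0 \<in> range (\<lambda>r. su (cis (r / 2)) 0)" for \<phi>
      by (rule range_eqI[of _ _ "2 * \<phi>"]) simp
    then show ?thesis by blast
  qed
  finally show ?thesis .
qed

lemma exp_k_minus_identity:
  "matrix_exp ` k_part - {mat 1} = {su (cis \<phi>) 0 | \<phi>. 0 < \<phi> \<and> \<phi> < 2 * pi}"
proof (intro set_eqI iffI)
  fix q assume "q \<in> matrix_exp ` k_part - {mat 1}"
  then obtain \<psi> where q: "q = su (cis \<psi>) 0" "q \<noteq> mat 1"
    unfolding exp_k_eq by auto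
  obtain \<phi> where \<phi>: "0 \<le> \<phi>" "\<phi> < 2 * pi" "cis \<psi> = cis \<phi>"
    by (rule unit_complex_eq_cis[of "cis \<psi>"]) auto
  have "\<phi> \<noteq> 0" using q \<phi> su_one by auto
  then show "q \<in> {su (cis \<phi>) 0 | \<phi>. 0 < \<phi> \<and> \<phi> < 2 * pi}"
    using q \<phi> by fastforce
next
  fix q assume "q \<in> {su (cis \<phi>) 0 | \<phi>. 0 < \<phi> \<and> \<phi> < 2 * pi}"
  then obtain \<phi> where \<phi>: "q = su (cis \<phi>) 0" "0 < \<phi>" "\<phi> < 2 * pi" by auto
  have "cis \<phi> \<noteq> cis 0"
  proof
    assume "cis \<phi> = cis 0"
    then have "cos \<phi> = 1" by (simp add: complex_eq_iff)
    then obtain n :: int where "\<phi> = of_int n * 2 * pi"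
      using cos_one_2pi_int by auto
    then show False
      using \<phi> by (simp add: zero_less_mult_iff mult_less_cancel_right)
  qed
  then have "q \<noteq> mat 1"
    by (simp add: \<phi> su_eq_iff flip: su_one)
  then show "q \<in> matrix_exp ` k_part - {mat 1}"
    unfolding exp_k_eq using \<phi> by auto
qed

lemma exp_k_in_cut_locus:
  assumes \<phi>: "0 < \<phi>" "\<phi> < 2 * pi"
  shows "su (cis \<phi>) 0 \<in> cut_locus"
proof -
  \<comment> \<open>At \<omega> t = 2 pi the first entry is - cis(- c t / 2) = cis(pi - s pi) with s
    = c / \<omega>. Solving pi - s pi = \<phi> gives s, and then \<omega> = 1 / \<rho>, c = s /
    \<rho> and t = 2 pi \<rho>.\<close>
  define s where "s = 1 - \<phi> / pi"
  define \<rho> where "\<rho> = sqrt (1 - s\<^sup>2)"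
  define c where "c = s / \<rho>"
  define t where "t = 2 * pi * \<rho>"
  have "\<bar>s\<bar> < 1" using \<phi> by (auto simp: s_def abs_less_iff field_simps)
  then have s2: "s\<^sup>2 < 1" by (simp add: abs_square_less_1)
  have \<rho>: "0 < \<rho>" "\<rho>\<^sup>2 = 1 - s\<^sup>2" using s2 by (simp_all add: \<rho>_def)
  have "1 + c\<^sup>2 = (1 / \<rho>)\<^sup>2"
  proof -
    have "1 + c\<^sup>2 = (\<rho>\<^sup>2 + s\<^sup>2) / \<rho>\<^sup>2"
      using \<rho>(1) by (simp add: c_def power_divide add_divide_distrib)
    also have "\<rho>\<^sup>2 + s\<^sup>2 = 1" by (simp add: \<rho>(2))
    finally show ?thesis by (simp add: power_divide)
  qed
  then have om: "sqrt (1 + c\<^sup>2) = 1 / \<rho>"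
    using \<rho>(1) by (simp add: real_sqrt_unique)
  have x: "1 / \<rho> * t / 2 = pi" and ct: "c * t / 2 = s * pi" and t0: "0 < t"
    using \<rho>(1) by (auto simp: t_def c_def)
  have Exp: "Exp \<theta> c t = su (cis \<phi>) 0" for \<theta>
  proof -
    have "pi - s * pi = \<phi>" by (simp add: s_def field_simps)
    moreover have "cis (pi - s * pi) = - cis (- (s * pi))"
      using minus_cis[of "- (s * pi)"] by simp
    ultimately show ?thesis
      unfolding Exp_eq_su om x ct by (simp add: su_eq_iff complex_eq_iff)
  qed
  \<comment> \<open>The arrival time agrees with the lower bound for the length.\<close>
  have t_eq: "t = 2 * sqrt (\<phi> * (2 * pi - \<phi>))"
  proof -
    have \<phi>_eq: "\<phi> = pi * (1 - s)" by (simp add: s_def)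
    have "\<phi> * (2 * pi - \<phi>) = pi\<^sup>2 * (1 - s\<^sup>2)"
      unfolding \<phi>_eq by (simp add: power2_eq_square algebra_simps)
    then show ?thesis
      by (simp add: t_def \<rho>_def real_sqrt_mult)
  qed
  have opt: "optimal \<theta> c t" for \<theta>
  proof -
    have reach: "reach t (mat 1) (su (cis \<phi>) 0)"
      using reach_Exp_from_identity[of t \<theta> c] t0 by (simp add: Exp)
    have "t \<le> sr_dist (mat 1) (su (cis \<phi>) 0)"
      unfolding sr_dist_def
    proof (rule cInf_greatest)
      show "{sr_length T \<gamma> |T \<gamma>. 0 < T \<and> horizontal T \<gamma> \<and> \<gamma> 0 = mat 1 \<and> \<gamma> T = su (cis \<phi>) 0} \<noteq> {}"
        using reach_imp_sr_dist_le(2)[OF reach t0] t0 by blast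
      show "t \<le> l" if "l \<in> {sr_length T \<gamma> |T \<gamma>. 0 < T \<and> horizontal T \<gamma> \<and> \<gamma> 0 = mat 1 \<and> \<gamma> T = su (cis \<phi>) 0}" for l
        using that sr_length_lower_bound[OF _ _ _ _ \<phi>] t_eq by auto
    qed
    with reach_imp_sr_dist_le(1)[OF reach t0] show ?thesis
      by (simp add: optimal_def Exp)
  qed
  \<comment> \<open>The end point and optimality do not depend on the angle, so any two distinct
    angles exhibit a cut point.\<close>
  have "\<not> [0 = pi] (rmod (2 * pi))"
    by (simp flip: cis_eq_iff_rcong)
  then show ?thesis
    unfolding cut_locus_def using t0 opt[of 0] opt[of pi] Exp[of 0] Exp[of pi]
    by (intro CollectI exI[of _ 0] exI[of _ c] exI[of _ pi] exI[of _ t]) auto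
qed

lemma optimal_frequency_unique:
  assumes t: "0 < t" and eq: "Exp \<theta>\<^sub>1 c\<^sub>1 t = Exp \<theta>\<^sub>2 c\<^sub>2 t"
    and opt: "optimal \<theta>\<^sub>1 c\<^sub>1 t" "optimal \<theta>\<^sub>2 c\<^sub>2 t"
  shows "c\<^sub>1 = c\<^sub>2"
proof -
  define \<omega> where "\<omega> c = sqrt (1 + c\<^sup>2)" for c :: real
  have om: "0 < \<omega> c" "(\<omega> c)\<^sup>2 = 1 + c\<^sup>2" for c
    by (simp_all add: \<omega>_def add_pos_nonneg)
  have le: "\<omega> c\<^sub>1 * t \<le> 2 * pi" "\<omega> c\<^sub>2 * t \<le> 2 * pi"
    using opt optimal_imp_before_cusp by (auto simp: \<omega>_def)
  have b: "cmod (Exp \<theta> c t $ 1 $ 2) = sin (\<omega> c * t / 2) / \<omega> c" if "\<omega> c * t \<le> 2 * pi" for \<theta> c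
  proof -
    have "0 \<le> sin (\<omega> c * t / 2)"
      using that t om(1)[of c] by (intro sin_ge_zero) auto
    then show ?thesis
      using om(1)[of c] unfolding Exp_eq_su \<omega>_def[symmetric] by (simp add: norm_mult norm_divide)
  qed
  have r: "sin (\<omega> c\<^sub>1 * t / 2) / \<omega> c\<^sub>1 = sin (\<omega> c\<^sub>2 * t / 2) / \<omega> c\<^sub>2"
    using b[OF le(1), of \<theta>\<^sub>1] b[OF le(2), of \<theta>\<^sub>2] eq by simp
  have om_eq: "\<omega> c\<^sub>1 = \<omega> c\<^sub>2"
    using sin_over_frequency_strict_antimono[of "\<omega> c\<^sub>1" "\<omega> c\<^sub>2" t]
      sin_over_frequency_strict_antimono[of "\<omega> c\<^sub>2" "\<omega> c\<^sub>1" t] om(1) t le r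
    by (metis less_irrefl linorder_neqE_linordered_idom)
  then have "c\<^sub>1\<^sup>2 = c\<^sub>2\<^sup>2"
    using om(2)[of c\<^sub>1] om(2)[of c\<^sub>2] by simp
  then consider "c\<^sub>1 = c\<^sub>2" | "c\<^sub>1 = - c\<^sub>2" by (auto simp: power2_eq_iff)
  then show ?thesis
  proof cases
    case 2
    define x where "x = \<omega> c\<^sub>2 * t / 2"
    define s where "s = c\<^sub>2 / \<omega> c\<^sub>2"
    have x: "0 < x" "x \<le> pi"
      using t om(1) le by (auto simp: x_def)
    have sx: "c\<^sub>2 * t / 2 = s * x" "c\<^sub>1 * t / 2 = - (s * x)"
      using om(1)[of c\<^sub>2] 2 by (auto simp: s_def x_def)
    have s1: "\<bar>s\<bar> < 1"
    proof -
      have "\<bar>c\<^sub>2\<bar>\<^sup>2 < (\<omega> c\<^sub>2)\<^sup>2" by (simp add: om(2))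
      then have "\<bar>c\<^sub>2\<bar> < \<omega> c\<^sub>2" by (rule power2_less_imp_less) (use om(1)[of c\<^sub>2] in simp)
      then show ?thesis using om(1)[of c\<^sub>2] by (simp add: s_def)
    qed
    have "Complex (cos x) (- (s * sin x)) * cis (s * x) = Complex (cos x) (s * sin x) * cis (- (s * x))"
      using eq unfolding Exp_eq_su \<omega>_def[symmetric] om_eq x_def[symmetric] sx su_eq_iff
      by (simp add: s_def 2)
    \<comment> \<open>For opposite values of c the first entries are complex conjugates, so equality
      makes their imaginary part vanish.\<close>
    then have "Im (Complex (cos x) (- (s * sin x)) * cis (s * x)) = Im (Complex (cos x) (s * sin x) * cis (- (s * x)))"
      by (rule arg_cong)
    then have zero: "s * sin x * cos (s * x) - cos x * sin (s * x) = 0"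
      by simp
    have "s = 0"
    proof (rule ccontr)
      assume "s \<noteq> 0"
      then consider "0 < s" | "0 < - s" by linarith
      then show False
        using phase_sin_pos[of s x] phase_sin_pos[of "- s" x] x s1 zero by cases auto
    qed
    then show ?thesis using 2 om(1)[of c\<^sub>2] by (simp add: s_def)
  qed
qed

lemma cut_locus_subset: "cut_locus \<subseteq> matrix_exp ` k_part - {mat 1}"
proof
  fix q assume "q \<in> cut_locus"
  then obtain \<theta>\<^sub>1 c\<^sub>1 \<theta>\<^sub>2 c\<^sub>2 t where ne: "\<not> ([\<theta>\<^sub>1 = \<theta>\<^sub>2] (rmod (2 * pi)) \<and> c\<^sub>1 = c\<^sub>2)" and t: "0 < t"
    and q: "q = Exp \<theta>\<^sub>1 c\<^sub>1 t" "q = Exp \<theta>\<^sub>2 c\<^sub>2 t" and opt: "optimal \<theta>\<^sub>1 c\<^sub>1 t" "optimal \<theta>\<^sub>2 c\<^sub>2 t"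
    unfolding cut_locus_def by blast
  have "q \<noteq> mat 1"
  proof
    assume "q = mat 1"
    \<comment> \<open>A geodesic returning to the identity is not optimal, because the distance is
      at most t / 2 there.\<close>
    then have "sr_dist (mat 1) (mat 1) = t"
      using opt(1) q(1) by (simp add: optimal_def)
    with sr_dist_identity[of "t / 2"] t show False by simp
  qed
  have c: "c\<^sub>1 = c\<^sub>2"
    by (rule optimal_frequency_unique[OF t _ opt]) (use q in simp)
  define a b where "a = q $ 1 $ 1" and "b = q $ 1 $ 2"
  have qab: "q = su a b"
    unfolding a_def b_def q(1) Exp_eq_su by simp
  have "b = 0"
  proof (rule ccontr)
    assume "b \<noteq> 0"
    define r where "r = of_real (sin (sqrt (1 + c\<^sub>2\<^sup>2) * t / 2) / sqrt (1 + c\<^sub>2\<^sup>2)) * cis (c\<^sub>2 * t / 2)"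
    have "b = cis \<theta>\<^sub>1 * r"
      unfolding b_def q(1) Exp_eq_su r_def c by simp
    moreover have "b = cis \<theta>\<^sub>2 * r"
      unfolding b_def q(2) Exp_eq_su r_def by simp
    ultimately have "cis \<theta>\<^sub>1 = cis \<theta>\<^sub>2"
      using \<open>b \<noteq> 0\<close> by auto
    with ne c show False by (simp add: cis_eq_iff_rcong)
  qed
  have "q \<in> SU2"
    using reach_in_SU2[OF reach_Exp_from_identity[of t \<theta>\<^sub>1 c\<^sub>1]] t q(1) by simp
  then have "(cmod a)\<^sup>2 = 1\<^sup>2"
    using \<open>b = 0\<close> by (simp add: qab su_in_SU2_iff)
  then have "cmod a = 1"
    by (rule power2_eq_imp_eq) simp_all
  then obtain \<phi> where "a = cis \<phi>"
    by (rule unit_complex_eq_cis)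
  then have "q \<in> matrix_exp ` k_part"
    unfolding exp_k_eq qab using \<open>b = 0\<close> by blast
  with \<open>q \<noteq> mat 1\<close> show "q \<in> matrix_exp ` k_part - {mat 1}" by simp
qed

theorem theorem1:
  shows "cut_locus = matrix_exp ` k_part - {mat 1}
       \<and> matrix_exp ` k_part - {mat 1} = {matrix_exp (c *\<^sub>R k0) | c. c \<in> {0<..<4 * pi}}"
proof
  show "cut_locus = matrix_exp ` k_part - {mat 1}"
    using cut_locus_subset exp_k_in_cut_locus unfolding exp_k_minus_identity by blast
  \<comment> \<open>The factor 1/2 in \<open>k0\<close> makes the phase c/2, so phases in (0, 2 pi)
    correspond to c in (0, 4 pi).\<close>
  have "{su (cis \<phi>) 0 | \<phi>. 0 < \<phi> \<and> \<phi> < 2 * pi} = {matrix_exp (c *\<^sub>R k0) | c. c \<in> {0<..<4 * pi}}"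
    unfolding matrix_exp_k
  proof (intro set_eqI iffI; clarsimp)
    fix \<phi> :: real assume "0 < \<phi>" "\<phi> < 2 * pi"
    then show "\<exists>c. su (cis \<phi>) 0 = su (cis (c / 2)) 0 \<and> 0 < c \<and> c < 4 * pi"
      by (intro exI[of _ "2 * \<phi>"]) auto
  next
    fix c :: real assume "0 < c" "c < 4 * pi"
    then show "\<exists>\<phi>. su (cis (c / 2)) 0 = su (cis \<phi>) 0 \<and> 0 < \<phi> \<and> \<phi> < 2 * pi"
      by (intro exI[of _ "c / 2"]) auto
  qed
  then show "matrix_exp ` k_part - {mat 1} = {matrix_exp (c *\<^sub>R k0) | c. c \<in> {0<..<4 * pi}}"
    unfolding exp_k_minus_identity .
qed

end
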